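(* Let $K$ be a commutative ring with unit, let $S$ be an inverse semigroup, let $\theta\colon S\to I_X$ be an ample action such that the groupoid of germs $S\ltimes X$ is Hausdorff, and let $A$ be a $K$-algebra. Then there is a bijection between $K$-algebra homomorphisms $\varphi\colon K(S\ltimes X)\to A$ and covariant representations $(\pi,\sigma)$ of $(\theta,S,X)$ on $A$.
   Context: An inverse semigroup is a semigroup $S$ such that each $s\in S$ has a unique $s^*$ with $ss^*s=s$, $s^*ss^*=s^*$. $E(S)$ is its commutative semigroup of idempotents; $s\le t$ iff $s=et$ for some $e\in E(S)$. $K$-algebras are associative, not necessarily unital. For a locally compact Hausdorff space $X$, $I_X$ is the inverse semigroup of homeomorphisms between open subsets of $X$. An action of $S$ on $X$ is a homomorphism $\theta\colon S\to I_X$; write $sx=\theta_s(x)$ and $X_e$ for the domain of $\theta_e$, $e\in E(S)$. It is non-degenerate if $X=\bigcup_{e\in E(S)}X_e$. It is ample if it is non-degenerate, $X$ is Hausdorff with a basis of compact open sets, and each $X_e$ is compact open. The groupoid of germs $S\ltimes X$ is the set of classes $[s,x]$ of pairs $(s,x)$ with $x\in X_{s^*s}$, where $(s,x)\sim(t,y)$ iff $x=y$ and there is $u\le s,t$ with $x\in X_{u^*u}$. Its topology has as basis the sets $(s,U)=\{[s,x]\mid x\in U\}$ with $U\subseteq X_{s^*s}$ open. The product $[s,x][t,y]=[st,y]$ is defined iff $ty=x$; $[s,x]^{-1}=[s^*,sx]$, $d([s,x])=x$, $r([s,x])=sx$ (unit space identified with $X$ via $[e,x]\mapsto x$). Give $K$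 the discrete topology. For a Hausdorff ample groupoid $\mathscr G$ such as $S\ltimes X$, $K\mathscr G$ is the $K$-algebra of continuous compactly supported functions $\mathscr G\to K$, with product $f\ast g(x)=\sum_{y\in d^{-1}(d(x))}f(xy^{-1})g(y)$. For a Hausdorff space $Y$ with a basis of compact open sets, $KY$ is the algebra of continuous compactly supported functions $Y\to K$ with pointwise product; for $Y\subseteq X$ open, $KY\subseteq KX$ by extension by $0$. A covariant representation of $(\theta,S,X)$ on $A$ is a pair $(\pi,\sigma)$ where $\pi\colon KX\to A$ is a $K$-algebra homomorphism and $\sigma\colon S\to A$ is a homomorphism (to the multiplicative semigroup of $A$) such that (1) $\pi(f\theta_{s^*})=\sigma(s)\pi(f)\sigma(s^* )$ for all $s\in S$, $f\in KX_{s^*s}$, where $f\theta_{s^*}$ is $x\mapsto f(s^*x)$ on $X_{ss^*}$ and $0$ elsewhere; and (2) $\pi(\chi_{X_e})=\sigma(e)$ for all $e\in E(S)$. *)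

theory Defs
  imports "HOL-Analysis.Analysis"
begin

section \<open>Inverse semigroups\<close>

class inverse_semigroup = semigroup_mult +
  assumes ex1_inverse: "\<exists>!t. s * t * s = s \<and> t * s * t = t"
begin

definition star :: "'a \<Rightarrow> 'a"  ("_\<^sup>\<star>" [1000] 999)
  where "s\<^sup>\<star> = (THE t. s * t * s = s \<and> t * s * t = t)"

definition idems :: "'a set"
  where "idems = {e. e * e = e}"

definition nat_le :: "'a \<Rightarrow> 'a \<Rightarrow> bool"  (infix "\<preceq>" 50)
  where "s \<preceq> t \<longleftrightarrow> (\<exists>e\<in>idems. s = e * t)"

end


section \<open>Ample actions\<close>

text \<open>Partial maps are maps into \<^typ>\<open>'x option\<close>, with \<^term>\<open>dom f\<close> the domain, \<^term>\<open>ran f\<close>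
  the range, and the product of the inverse semigroup given by \<^term>\<open>f \<circ>\<^sub>m g\<close> (first \<open>g\<close>, then \<open>f\<close>,
  wherever this makes sense).\<close>

definition partial_homeos :: "'x topology \<Rightarrow> ('x \<rightharpoonup> 'x) set"
  where "partial_homeos X =
    {f. openin X (dom f) \<and> openin X (ran f) \<and>
        homeomorphic_map (subtopology X (dom f)) (subtopology X (ran f)) (\<lambda>x. the (f x))}"

definition semigroup_action :: "'x topology \<Rightarrow> ('s::inverse_semigroup \<Rightarrow> 'x \<rightharpoonup> 'x) \<Rightarrow> bool"
  where "semigroup_action X \<theta> \<longleftrightarrow>
    locally_compact_space X \<and> Hausdorff_space X \<and>
    (\<forall>s. \<theta> s \<in> partial_homeos X) \<and> (\<forall>s t. \<theta> (s * t) = \<theta> s \<circ>\<^sub>m \<theta> t)"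

definition compact_open_basis :: "'x topology \<Rightarrow> bool"
  where "compact_open_basis X \<longleftrightarrow>
    (\<exists>\<B>. (\<forall>B\<in>\<B>. openin X B \<and> compactin X B) \<and>
         (\<forall>U x. openin X U \<and> x \<in> U \<longrightarrow> (\<exists>B\<in>\<B>. x \<in> B \<and> B \<subseteq> U)))"

definition nondegenerate_action :: "'x topology \<Rightarrow> ('s::inverse_semigroup \<Rightarrow> 'x \<rightharpoonup> 'x) \<Rightarrow> bool"
  where "nondegenerate_action X \<theta> \<longleftrightarrow> topspace X = (\<Union>e\<in>idems. dom (\<theta> e))"

definition ample_action :: "'x topology \<Rightarrow> ('s::inverse_semigroup \<Rightarrow> 'x \<rightharpoonup> 'x) \<Rightarrow> bool"
  where "ample_action X \<theta> \<longleftrightarrow>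
    semigroup_action X \<theta> \<and> nondegenerate_action X \<theta> \<and>
    Hausdorff_space X \<and> compact_open_basis X \<and>
    (\<forall>e\<in>idems. compactin X (dom (\<theta> e)) \<and> openin X (dom (\<theta> e)))"


section \<open>The groupoid of germs\<close>

definition germ_pairs :: "('s::inverse_semigroup \<Rightarrow> 'x \<rightharpoonup> 'x) \<Rightarrow> ('s \<times> 'x) set"
  where "germ_pairs \<theta> = {(s, x). x \<in> dom (\<theta> (s\<^sup>\<star> * s))}"

definition germ_rel :: "('s::inverse_semigroup \<Rightarrow> 'x \<rightharpoonup> 'x) \<Rightarrow> (('s \<times> 'x) \<times> ('s \<times> 'x)) set"
  where "germ_rel \<theta> = {((s, x), (t, y)). (s, x) \<in> germ_pairs \<theta> \<and> (t, y) \<in> germ_pairs \<theta> \<and>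
    x = y \<and> (\<exists>u. u \<preceq> s \<and> u \<preceq> t \<and> x \<in> dom (\<theta> (u\<^sup>\<star> * u)))}"

definition germs :: "('s::inverse_semigroup \<Rightarrow> 'x \<rightharpoonup> 'x) \<Rightarrow> ('s \<times> 'x) set set"
  where "germs \<theta> = germ_pairs \<theta> // germ_rel \<theta>"

definition germ :: "('s::inverse_semigroup \<Rightarrow> 'x \<rightharpoonup> 'x) \<Rightarrow> 's \<Rightarrow> 'x \<Rightarrow> ('s \<times> 'x) set"
  where "germ \<theta> s x = germ_rel \<theta> `` {(s, x)}"

definition germ_basis ::
    "'x topology \<Rightarrow> ('s::inverse_semigroup \<Rightarrow> 'x \<rightharpoonup> 'x) \<Rightarrow> ('s \<times> 'x) set set set"
  where "germ_basis X \<theta> = {germ \<theta> s ` U | s U. openin X U \<and> U \<subseteq> dom (\<theta> (s\<^sup>\<star> * s))}"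

text \<open>Lemma \<open>istopology_germ_basis\<close> below shows that unions of members of
  \<open>germ_basis\<close> really do form a topology, so that \<^const>\<open>topology\<close> is applied meaningfully.\<close>

definition germ_topology ::
    "'x topology \<Rightarrow> ('s::inverse_semigroup \<Rightarrow> 'x \<rightharpoonup> 'x) \<Rightarrow> ('s \<times> 'x) set topology"
  where "germ_topology X \<theta> = topology (arbitrary union_of (\<lambda>W. W \<in> germ_basis X \<theta>))"

text \<open>The structure maps are given by their values on representatives; lemmas \<open>germ_d_germ\<close>,
  \<open>germ_inv_germ\<close> and \<open>germ_mult_germ\<close> below show that they are well defined.
  The value of \<^term>\<open>germ_mult \<theta> g h\<close> is unspecified if the product is undefined.\<close>

definition germ_d :: "('s::inverse_semigroup \<Rightarrow> 'x \<rightharpoonup> 'x) \<Rightarrow> ('s \<times> 'x) set \<Rightarrow> 'x"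
  where "germ_d \<theta> g = (THE x. \<exists>s. (s, x) \<in> germ_pairs \<theta> \<and> g = germ \<theta> s x)"

definition germ_inv :: "('s::inverse_semigroup \<Rightarrow> 'x \<rightharpoonup> 'x) \<Rightarrow> ('s \<times> 'x) set \<Rightarrow> ('s \<times> 'x) set"
  where "germ_inv \<theta> g =
    (THE h. \<exists>s x. (s, x) \<in> germ_pairs \<theta> \<and> g = germ \<theta> s x \<and> h = germ \<theta> (s\<^sup>\<star>) (the (\<theta> s x)))"

definition germ_mult ::
    "('s::inverse_semigroup \<Rightarrow> 'x \<rightharpoonup> 'x) \<Rightarrow> ('s \<times> 'x) set \<Rightarrow> ('s \<times> 'x) set \<Rightarrow> ('s \<times> 'x) set"
  where "germ_mult \<theta> g h =
    (THE k. \<exists>s x t y. (s, x) \<in> germ_pairs \<theta> \<and> g = germ \<theta> s x \<and>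
                      (t, y) \<in> germ_pairs \<theta> \<and> h = germ \<theta> t y \<and>
                      \<theta> t y = Some x \<and> k = germ \<theta> (s * t) y)"


section \<open>Algebras of functions\<close>

text \<open>The sort \<open>{comm_ring, comm_monoid_mult}\<close> is that of commutative rings with unit; unlike
  \<open>comm_ring_1\<close> it does not exclude the zero ring.

  A function on a space \<open>Y\<close> is represented by its extension by \<open>0\<close> to the whole type. In this way
  the functions for an open subspace of \<open>X\<close> are literally among those for \<open>X\<close>.\<close>

definition cc_functions :: "'y topology \<Rightarrow> ('y \<Rightarrow> 'k::{comm_ring, comm_monoid_mult}) set"
  where "cc_functions Y =
    {f. continuous_map Y (discrete_topology UNIV) f \<and>
        compactin Y (Y closure_of {y \<in> topspace Y. f y \<noteq> 0}) \<and>
        (\<forall>y. y \<notin> topspace Y \<longrightarrow> f y = 0)}"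

definition pointwise_mult :: "('y \<Rightarrow> 'k::{comm_ring, comm_monoid_mult}) \<Rightarrow> ('y \<Rightarrow> 'k) \<Rightarrow> 'y \<Rightarrow> 'k"
  where "pointwise_mult f g = (\<lambda>y. f y * g y)"

text \<open>The fibre \<open>d\<^sup>-\<^sup>1(d(g))\<close> may be infinite, and \<^const>\<open>sum\<close> vanishes on infinite index sets,
  so the sum is taken over the indices of the (finitely many) nonzero terms.\<close>

definition convolution ::
    "('s::inverse_semigroup \<Rightarrow> 'x \<rightharpoonup> 'x) \<Rightarrow>
     (('s \<times> 'x) set \<Rightarrow> 'k::{comm_ring, comm_monoid_mult}) \<Rightarrow> (('s \<times> 'x) set \<Rightarrow> 'k) \<Rightarrow>
     ('s \<times> 'x) set \<Rightarrow> 'k"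
  where "convolution \<theta> a b = (\<lambda>g. if g \<in> germs \<theta> then
      (\<Sum>h | h \<in> germs \<theta> \<and> germ_d \<theta> h = germ_d \<theta> g \<and>
             a (germ_mult \<theta> g (germ_inv \<theta> h)) * b h \<noteq> 0.
         a (germ_mult \<theta> g (germ_inv \<theta> h)) * b h) else 0)"


section \<open>Homomorphisms and covariant representations\<close>

locale K_algebra =
  fixes smul :: "'k::{comm_ring, comm_monoid_mult} \<Rightarrow> 'a::ring \<Rightarrow> 'a"
  assumes smul_add_right: "smul c (a + b) = smul c a + smul c b"
    and smul_add_left: "smul (c + c') a = smul c a + smul c' a"
    and smul_smul: "smul c (smul c' a) = smul (c * c') a"
    and smul_one: "smul 1 a = a"
    and smul_mult_left: "smul c a * b = smul c (a * b)"
    and smul_mult_right: "a * smul c b = smul c (a * b)"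

text \<open>A homomorphism from an algebra of functions, with carrier \<open>C\<close>, pointwise module structure and
  product \<open>mul\<close>. Homomorphisms are taken to be \<^const>\<open>undefined\<close> outside \<open>C\<close>, so
  that they are determined by their values on \<open>C\<close>.\<close>

definition algebra_homs ::
    "('k::{comm_ring, comm_monoid_mult} \<Rightarrow> 'a::ring \<Rightarrow> 'a) \<Rightarrow> ('y \<Rightarrow> 'k) set \<Rightarrow>
     (('y \<Rightarrow> 'k) \<Rightarrow> ('y \<Rightarrow> 'k) \<Rightarrow> 'y \<Rightarrow> 'k) \<Rightarrow> (('y \<Rightarrow> 'k) \<Rightarrow> 'a) set"
  where "algebra_homs smul C mul =
    {\<phi>. \<phi> \<in> C \<rightarrow>\<^sub>E UNIV \<and>
        (\<forall>f\<in>C. \<forall>g\<in>C. \<phi> (\<lambda>y. f y + g y) = \<phi> f + \<phi> g) \<and>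
        (\<forall>c. \<forall>f\<in>C. \<phi> (\<lambda>y. c * f y) = smul c (\<phi> f)) \<and>
        (\<forall>f\<in>C. \<forall>g\<in>C. \<phi> (mul f g) = \<phi> f * \<phi> g)}"

definition translate ::
    "('s::inverse_semigroup \<Rightarrow> 'x \<rightharpoonup> 'x) \<Rightarrow> 's \<Rightarrow> ('x \<Rightarrow> 'k::{comm_ring, comm_monoid_mult}) \<Rightarrow> 'x \<Rightarrow> 'k"
  where "translate \<theta> s f = (\<lambda>x. if x \<in> dom (\<theta> (s * s\<^sup>\<star>)) then f (the (\<theta> (s\<^sup>\<star>) x)) else 0)"

definition char_fun :: "'x set \<Rightarrow> 'x \<Rightarrow> 'k::{comm_ring, comm_monoid_mult}"
  where "char_fun U = (\<lambda>x. if x \<in> U then 1 else 0)"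

definition covariant_reps ::
    "('k::{comm_ring, comm_monoid_mult} \<Rightarrow> 'a::ring \<Rightarrow> 'a) \<Rightarrow> 'x topology \<Rightarrow>
     ('s::inverse_semigroup \<Rightarrow> 'x \<rightharpoonup> 'x) \<Rightarrow> ((('x \<Rightarrow> 'k) \<Rightarrow> 'a) \<times> ('s \<Rightarrow> 'a)) set"
  where "covariant_reps smul X \<theta> =
    {(\<pi>, \<sigma>). \<pi> \<in> algebra_homs smul (cc_functions X) pointwise_mult \<and>
        (\<forall>s t. \<sigma> (s * t) = \<sigma> s * \<sigma> t) \<and>
        (\<forall>s. \<forall>f\<in>cc_functions (subtopology X (dom (\<theta> (s\<^sup>\<star> * s)))).
            \<pi> (translate \<theta> s f) = \<sigma> s * \<pi> f * \<sigma> (s\<^sup>\<star>)) \<and>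
        (\<forall>e\<in>idems. \<pi> (char_fun (dom (\<theta> e))) = \<sigma> e)}"


section \<open>The germ groupoid is well defined\<close>

context inverse_semigroup
begin

lemma star_inverse: "s * s\<^sup>\<star> * s = s" "s\<^sup>\<star> * s * s\<^sup>\<star> = s\<^sup>\<star>"
  using theI'[OF ex1_inverse[of s]] by (simp_all add: star_def)

lemma star_unique:
  assumes "s * t * s = s" "t * s * t = t"
  shows "s\<^sup>\<star> = t"
  using assms ex1_inverse[of s] star_inverse[of s] by blast

lemma star_star: "(s\<^sup>\<star>)\<^sup>\<star> = s"
  using star_inverse star_unique by blast

lemma star_idem: "e \<in> idems \<Longrightarrow> e\<^sup>\<star> = e"
  by (simp add: idems_def star_unique)

lemma star_mult_idem: "s\<^sup>\<star> * s \<in> idems" "s * s\<^sup>\<star> \<in> idems"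
  by (auto simp: idems_def star_inverse simp flip: mult.assoc)

lemma idem_mult_idem:
  assumes "e \<in> idems" "f \<in> idems"
  shows "e * f \<in> idems"
proof -
  have ee: "e * e = e" "f * f = f"
    using assms by (auto simp: idems_def)
  have eex: "e * (e * z) = e * z" "f * (f * z) = f * z" for z
    using ee by (simp_all flip: mult.assoc)
  define x where "x = (e * f)\<^sup>\<star>"
  have 1: "e * (f * (x * (e * f))) = e * f" "x * (e * (f * x)) = x"
    using star_inverse[of "e * f"] by (simp_all add: x_def mult.assoc)
  have 2: "x * (e * (f * (x * z))) = x * z" for z
    using 1(2) by (metis mult.assoc)
  have fxe: "x = f * x * e"
    unfolding x_def
    by (rule star_unique) (simp_all flip: x_def add: mult.assoc eex 1 2)
  then have "x * x = (f * x * e) * (f * x * e)" by simp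
  also have "\<dots> = f * (x * (e * (f * (x * e))))" by (simp only: mult.assoc)
  also have "\<dots> = f * x * e" by (simp only: 2 mult.assoc)
  also have "\<dots> = x" using fxe by simp
  finally have x: "x \<in> idems" by (simp add: idems_def)
  then have "x = e * f"
    using star_idem[OF x] star_star[of "e * f"] by (simp add: x_def)
  with x show ?thesis by simp
qed

lemma idem_commute:
  assumes "e \<in> idems" "f \<in> idems"
  shows "e * f = f * e"
proof -
  have ee: "e * e = e" "f * f = f"
    using assms by (auto simp: idems_def)
  have eex: "e * (e * z) = e * z" "f * (f * z) = f * z" for z
    using ee by (simp_all flip: mult.assoc)
  have ef: "e * (f * (e * f)) = e * f" "f * (e * (f * e)) = f * e"
    using idem_mult_idem[OF assms] idem_mult_idem[OF assms(2,1)]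
    by (simp_all add: idems_def mult.assoc)
  have "(e * f)\<^sup>\<star> = f * e"
    by (rule star_unique) (simp_all add: mult.assoc eex ef)
  then show ?thesis
    using star_idem[OF idem_mult_idem[OF assms]] by simp
qed

lemma star_mult: "(s * t)\<^sup>\<star> = t\<^sup>\<star> * s\<^sup>\<star>"
proof (rule star_unique)
  have c: "t * t\<^sup>\<star> * (s\<^sup>\<star> * s) = s\<^sup>\<star> * s * (t * t\<^sup>\<star>)"
    by (rule idem_commute) (rule star_mult_idem)+
  have "s * t * (t\<^sup>\<star> * s\<^sup>\<star>) * (s * t) = s * (t * t\<^sup>\<star> * (s\<^sup>\<star> * s)) * t"
    by (simp add: mult.assoc)
  also have "\<dots> = (s * s\<^sup>\<star> * s) * (t * t\<^sup>\<star> * t)"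
    unfolding c by (simp add: mult.assoc)
  finally show "s * t * (t\<^sup>\<star> * s\<^sup>\<star>) * (s * t) = s * t"
    by (simp add: star_inverse)
  have "t\<^sup>\<star> * s\<^sup>\<star> * (s * t) * (t\<^sup>\<star> * s\<^sup>\<star>) = t\<^sup>\<star> * (s\<^sup>\<star> * s * (t * t\<^sup>\<star>)) * s\<^sup>\<star>"
    by (simp add: mult.assoc)
  also have "\<dots> = (t\<^sup>\<star> * t * t\<^sup>\<star>) * (s\<^sup>\<star> * s * s\<^sup>\<star>)"
    unfolding c[symmetric] by (simp add: mult.assoc)
  finally show "t\<^sup>\<star> * s\<^sup>\<star> * (s * t) * (t\<^sup>\<star> * s\<^sup>\<star>) = t\<^sup>\<star> * s\<^sup>\<star>"
    by (simp add: star_inverse)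
qed

lemma nat_le_refl: "s \<preceq> s"
  using star_inverse(1)[of s] star_mult_idem(2)[of s] unfolding nat_le_def by metis

lemma conj_idem:
  assumes "e \<in> idems"
  shows "s * e * s\<^sup>\<star> \<in> idems"
proof -
  have "s * e * s\<^sup>\<star> * (s * e * s\<^sup>\<star>) = s * (e * (s\<^sup>\<star> * s)) * e * s\<^sup>\<star>"
    by (simp add: mult.assoc)
  also have "e * (s\<^sup>\<star> * s) = s\<^sup>\<star> * s * e"
    by (rule idem_commute[OF assms star_mult_idem(1)])
  also have "s * (s\<^sup>\<star> * s * e) * e * s\<^sup>\<star> = (s * s\<^sup>\<star> * s) * (e * e) * s\<^sup>\<star>"
    by (simp add: mult.assoc)
  finally show ?thesis
    using assms by (simp add: idems_def star_inverse)
qed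

lemma mult_idem_swap:
  assumes "e \<in> idems"
  shows "s * e = s * e * s\<^sup>\<star> * s"
proof -
  have "s * e * s\<^sup>\<star> * s = s * (e * (s\<^sup>\<star> * s))"
    by (simp add: mult.assoc)
  also have "e * (s\<^sup>\<star> * s) = s\<^sup>\<star> * s * e"
    by (rule idem_commute[OF assms star_mult_idem(1)])
  finally show ?thesis
    by (simp add: star_inverse flip: mult.assoc)
qed

lemma nat_le_iff_right: "s \<preceq> t \<longleftrightarrow> (\<exists>e\<in>idems. s = t * e)"
proof
  assume "s \<preceq> t"
  then obtain e where e: "e \<in> idems" "s = e * t" by (auto simp: nat_le_def)
  have "e * t = e * (t * t\<^sup>\<star>) * t"
    by (simp add: mult.assoc star_inverse(1)[unfolded mult.assoc])
  also have "e * (t * t\<^sup>\<star>) = t * t\<^sup>\<star> * e"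
    by (rule idem_commute[OF e(1) star_mult_idem(2)])
  finally have "s = t * (t\<^sup>\<star> * e * t)"
    using e by (simp add: mult.assoc)
  moreover have "t\<^sup>\<star> * e * t \<in> idems"
    using conj_idem[OF e(1), of "t\<^sup>\<star>"] by (simp add: star_star)
  ultimately show "\<exists>e\<in>idems. s = t * e" by blast
next
  assume "\<exists>e\<in>idems. s = t * e"
  then show "s \<preceq> t"
    using mult_idem_swap conj_idem unfolding nat_le_def by metis
qed

lemma nat_le_trans: "s \<preceq> t \<Longrightarrow> t \<preceq> u \<Longrightarrow> s \<preceq> u"
  unfolding nat_le_def by (metis idem_mult_idem mult.assoc)

lemma nat_le_mult:
  assumes "s \<preceq> s'" "t \<preceq> t'"
  shows "s * t \<preceq> s' * t'"
proof -
  obtain e f where "e \<in> idems" "s = e * s'" "f \<in> idems" "t = t' * f"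
    using assms nat_le_def nat_le_iff_right by metis
  then have "s * t = e * (s' * t' * f)" "e \<in> idems" "f \<in> idems"
    by (simp_all add: mult.assoc)
  then show ?thesis
    using nat_le_def nat_le_iff_right nat_le_trans by metis
qed

lemma nat_le_star:
  assumes "s \<preceq> t"
  shows "s\<^sup>\<star> \<preceq> t\<^sup>\<star>"
  using assms nat_le_iff_right nat_le_def star_mult star_idem by metis

end

context
  fixes X :: "'x topology" and \<theta> :: "'s::inverse_semigroup \<Rightarrow> 'x \<rightharpoonup> 'x"
  assumes act: "semigroup_action X \<theta>"
begin

lemma action_mult: "\<theta> (s * t) x = (case \<theta> t x of None \<Rightarrow> None | Some y \<Rightarrow> \<theta> s y)"
  using act by (simp add: semigroup_action_def map_comp_def)

lemma openin_dom_action: "openin X (dom (\<theta> s))"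
  using act by (simp add: semigroup_action_def partial_homeos_def)

lemma action_inj:
  assumes "\<theta> s x = Some z" "\<theta> s y = Some z"
  shows "x = y"
proof -
  have "dom (\<theta> s) \<subseteq> topspace X"
    using openin_dom_action openin_subset by blast
  moreover have "inj_on (\<lambda>x. the (\<theta> s x)) (topspace (subtopology X (dom (\<theta> s))))"
    using act by (simp add: semigroup_action_def partial_homeos_def homeomorphic_map_def)
  ultimately have "inj_on (\<lambda>x. the (\<theta> s x)) (dom (\<theta> s))"
    by (simp add: inf.absorb2)
  then show ?thesis
    using assms by (auto dest: inj_onD[of _ _ x y])
qed

lemma action_idem:
  assumes "e \<in> idems" "\<theta> e x = Some y"
  shows "y = x"
proof -
  have "\<theta> (e * e) x = Some y"
    using assms by (simp add: idems_def)
  then show ?thesis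
    using assms action_inj[of e y y x] by (simp add: action_mult)
qed

lemma dom_star_mult: "dom (\<theta> (s\<^sup>\<star> * s)) = dom (\<theta> s)"
proof
  show "dom (\<theta> (s\<^sup>\<star> * s)) \<subseteq> dom (\<theta> s)"
    by (auto simp: action_mult split: option.splits)
  have "dom (\<theta> (s * (s\<^sup>\<star> * s))) \<subseteq> dom (\<theta> (s\<^sup>\<star> * s))"
    by (auto simp: action_mult[of s "s\<^sup>\<star> * s"] split: option.splits)
  then show "dom (\<theta> s) \<subseteq> dom (\<theta> (s\<^sup>\<star> * s))"
    by (simp add: star_inverse flip: mult.assoc)
qed

lemma action_star:
  assumes "\<theta> s x = Some y"
  shows "\<theta> (s\<^sup>\<star>) y = Some x"
proof -
  have "x \<in> dom (\<theta> (s\<^sup>\<star> * s))"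
    using assms dom_star_mult by blast
  then obtain z where z: "\<theta> (s\<^sup>\<star> * s) x = Some z" by blast
  then have "z = x"
    using action_idem star_mult_idem(1) by blast
  with z assms show ?thesis by (simp add: action_mult)
qed

lemma action_nat_le:
  assumes "u \<preceq> s" "\<theta> u x = Some y"
  shows "\<theta> s x = Some y"
proof -
  obtain e where e: "e \<in> idems" "u = e * s"
    using assms by (auto simp: nat_le_def)
  then show ?thesis
    using assms action_idem[OF e(1)] by (auto simp: action_mult split: option.splits)
qed

lemma in_germ_rel_iff:
  "((s, x), (t, y)) \<in> germ_rel \<theta> \<longleftrightarrow> x = y \<and> (\<exists>u. u \<preceq> s \<and> u \<preceq> t \<and> x \<in> dom (\<theta> u))"
  unfolding germ_rel_def germ_pairs_def dom_star_mult
  using action_nat_le by (auto simp: dom_def)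

lemma equiv_germ_rel: "equiv (germ_pairs \<theta>) (germ_rel \<theta>)"
proof (rule equivI)
  show "germ_rel \<theta> \<subseteq> germ_pairs \<theta> \<times> germ_pairs \<theta>"
    by (auto simp: germ_rel_def)
  show "refl_on (germ_pairs \<theta>) (germ_rel \<theta>)"
    unfolding refl_on_def by (auto simp: germ_rel_def germ_pairs_def intro: nat_le_refl)
  show "sym (germ_rel \<theta>)"
    unfolding sym_def by (auto simp: in_germ_rel_iff)
  show "trans (germ_rel \<theta>)"
  proof (rule transI, clarsimp simp: in_germ_rel_iff)
    fix s t v u w :: 's and x y z
    assume u: "u \<preceq> s" "u \<preceq> t" and w: "w \<preceq> t" "w \<preceq> v"
      and x: "\<theta> u x = Some y" "\<theta> w x = Some z"
    obtain e f where e: "e \<in> idems" "u = e * t" and f: "f \<in> idems" "w = f * t"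
      using u w by (auto simp: nat_le_def)
    have "e * f * t = f * u" "e * f * t = e * w"
      using e f idem_commute[OF e(1) f(1)] by (simp_all flip: mult.assoc)
    then have "e * f * t \<preceq> u" "e * f * t \<preceq> w"
      using e(1) f(1) unfolding nat_le_def by blast+
    moreover have "\<exists>a. \<theta> (e * f * t) x = Some a"
    proof -
      have t: "\<theta> t x = Some y" "\<theta> t x = Some z"
        using action_nat_le u w x by blast+
      then have "\<theta> e y = Some y" "\<theta> f y = Some y"
        using x e f by (auto simp: action_mult)
      then show ?thesis
        using t by (simp add: action_mult)
    qed
    ultimately show "\<exists>u. u \<preceq> s \<and> u \<preceq> v \<and> x \<in> dom (\<theta> u)"
      using u w nat_le_trans by blast
  qed
qed

lemma germ_eq_iff:
  assumes "x \<in> dom (\<theta> s)" "y \<in> dom (\<theta> t)"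
  shows "germ \<theta> s x = germ \<theta> t y \<longleftrightarrow> x = y \<and> (\<exists>u. u \<preceq> s \<and> u \<preceq> t \<and> x \<in> dom (\<theta> u))"
proof -
  have "(s, x) \<in> germ_pairs \<theta>" "(t, y) \<in> germ_pairs \<theta>"
    using assms by (simp_all add: germ_pairs_def dom_star_mult)
  then show ?thesis
    by (simp add: germ_def eq_equiv_class_iff[OF equiv_germ_rel] in_germ_rel_iff)
qed

lemma istopology_germ_basis: "istopology (arbitrary union_of (\<lambda>W. W \<in> germ_basis X \<theta>))"
  unfolding istopology_base_eq
proof (intro allI impI, elim conjE)
  fix V W
  assume "V \<in> germ_basis X \<theta>" "W \<in> germ_basis X \<theta>"
  then obtain s U t U' where
    V: "V = germ \<theta> s ` U" "openin X U" "U \<subseteq> dom (\<theta> s)" and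
    W: "W = germ \<theta> t ` U'" "openin X U'" "U' \<subseteq> dom (\<theta> t)"
    unfolding germ_basis_def dom_star_mult by blast
  show "(arbitrary union_of (\<lambda>W. W \<in> germ_basis X \<theta>)) (V \<inter> W)"
    unfolding arbitrary_union_of_alt
  proof
    fix g
    assume "g \<in> V \<inter> W"
    then obtain x y where x: "g = germ \<theta> s x" "x \<in> U" and y: "g = germ \<theta> t y" "y \<in> U'"
      using V W by blast
    then have "x \<in> dom (\<theta> s)" "y \<in> dom (\<theta> t)" "germ \<theta> s x = germ \<theta> t y"
      using V W by auto
    then obtain u where u: "x = y" "u \<preceq> s" "u \<preceq> t" "x \<in> dom (\<theta> u)"
      by (auto simp: germ_eq_iff)
    define D where "D = U \<inter> U' \<inter> dom (\<theta> u)"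
    have eq: "germ \<theta> u z = germ \<theta> s z" "germ \<theta> u z = germ \<theta> t z" if "z \<in> D" for z
    proof -
      have z: "z \<in> dom (\<theta> u)" "z \<in> dom (\<theta> s)" "z \<in> dom (\<theta> t)"
        using that V(3) W(3) unfolding D_def by auto
      show "germ \<theta> u z = germ \<theta> s z" "germ \<theta> u z = germ \<theta> t z"
        using germ_eq_iff[OF z(1) z(2)] germ_eq_iff[OF z(1) z(3)] z(1) u(2,3) nat_le_refl[of u]
        by blast+
    qed
    have "germ \<theta> u ` D \<subseteq> V"
      unfolding V(1) using eq(1) by (auto simp: D_def)
    moreover have "germ \<theta> u ` D \<subseteq> W"
      unfolding W(1) using eq(2) by (auto simp: D_def)
    moreover have "openin X D" "D \<subseteq> dom (\<theta> (u\<^sup>\<star> * u))"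
      using V(2) W(2) openin_dom_action unfolding D_def dom_star_mult by blast+
    then have "germ \<theta> u ` D \<in> germ_basis X \<theta>"
      unfolding germ_basis_def by blast
    moreover have "x \<in> D"
      using x(2) y(2) u(1,4) by (simp add: D_def)
    then have "g \<in> germ \<theta> u ` D"
      using eq(1) x(1) by (metis imageI)
    ultimately show "\<exists>T. T \<in> germ_basis X \<theta> \<and> g \<in> T \<and> T \<subseteq> V \<inter> W" by blast
  qed
qed

lemma openin_germ_topology:
  "openin (germ_topology X \<theta>) = arbitrary union_of (\<lambda>W. W \<in> germ_basis X \<theta>)"
  unfolding germ_topology_def by (rule topology_inverse'[OF istopology_germ_basis])

lemma topspace_germ_topology: "topspace (germ_topology X \<theta>) = germs \<theta>"
proof
  show "topspace (germ_topology X \<theta>) \<subseteq> germs \<theta>"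
  proof
    fix g assume "g \<in> topspace (germ_topology X \<theta>)"
    then have "(arbitrary union_of (\<lambda>W. W \<in> germ_basis X \<theta>)) (topspace (germ_topology X \<theta>))"
      using openin_germ_topology openin_topspace by metis
    then obtain W where "W \<in> germ_basis X \<theta>" "g \<in> W"
      using \<open>g \<in> _\<close> unfolding arbitrary_union_of_alt by blast
    then obtain s x where "g = germ \<theta> s x" "(s, x) \<in> germ_pairs \<theta>"
      unfolding germ_basis_def germ_pairs_def by blast
    then show "g \<in> germs \<theta>"
      by (simp add: germs_def germ_def quotientI)
  qed
  show "germs \<theta> \<subseteq> topspace (germ_topology X \<theta>)"
  proof
    fix g assume "g \<in> germs \<theta>"
    then obtain s x where g: "g = germ \<theta> s x" "x \<in> dom (\<theta> (s\<^sup>\<star> * s))"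
      unfolding germs_def germ_pairs_def germ_def quotient_def by blast
    have "germ \<theta> s ` dom (\<theta> (s\<^sup>\<star> * s)) \<in> germ_basis X \<theta>"
      using openin_dom_action unfolding germ_basis_def by blast
    then have "openin (germ_topology X \<theta>) (germ \<theta> s ` dom (\<theta> (s\<^sup>\<star> * s)))"
      unfolding openin_germ_topology by (rule arbitrary_union_of_inc)
    then show "g \<in> topspace (germ_topology X \<theta>)"
      using g openin_subset by blast
  qed
qed

lemma germ_d_germ:
  assumes "x \<in> dom (\<theta> s)"
  shows "germ_d \<theta> (germ \<theta> s x) = x"
  unfolding germ_d_def germ_pairs_def dom_star_mult
proof (rule the_equality)
  show "\<exists>t. (t, x) \<in> {(s, x). x \<in> dom (\<theta> s)} \<and> germ \<theta> s x = germ \<theta> t x"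
    using assms by blast
next
  fix y
  assume "\<exists>t. (t, y) \<in> {(s, x). x \<in> dom (\<theta> s)} \<and> germ \<theta> s x = germ \<theta> t y"
  then obtain t where "y \<in> dom (\<theta> t)" "germ \<theta> s x = germ \<theta> t y" by blast
  then show "y = x"
    using germ_eq_iff[OF assms, of y t] by simp
qed

lemma germ_inv_germ:
  assumes "\<theta> s x = Some y"
  shows "germ_inv \<theta> (germ \<theta> s x) = germ \<theta> (s\<^sup>\<star>) y"
  unfolding germ_inv_def germ_pairs_def dom_star_mult
proof (rule the_equality)
  show "\<exists>s' x'. (s', x') \<in> {(s, x). x \<in> dom (\<theta> s)} \<and> germ \<theta> s x = germ \<theta> s' x' \<and>
      germ \<theta> (s\<^sup>\<star>) y = germ \<theta> (s'\<^sup>\<star>) (the (\<theta> s' x'))"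
    using assms by force
next
  fix h
  assume "\<exists>s' x'. (s', x') \<in> {(s, x). x \<in> dom (\<theta> s)} \<and> germ \<theta> s x = germ \<theta> s' x' \<and>
      h = germ \<theta> (s'\<^sup>\<star>) (the (\<theta> s' x'))"
  then obtain t x' y' where t: "\<theta> t x' = Some y'" "germ \<theta> s x = germ \<theta> t x'" "h = germ \<theta> (t\<^sup>\<star>) y'"
    by auto
  then obtain u where u: "x = x'" "u \<preceq> s" "u \<preceq> t" "x \<in> dom (\<theta> u)"
    using germ_eq_iff[OF domI[of "\<theta> s", OF assms] domI[of "\<theta> t", OF t(1)]] by blast
  then obtain z where z: "\<theta> u x = Some z" by blast
  then have "\<theta> u x = Some y" "y = y'"
    using action_nat_le[OF u(2) z] action_nat_le[OF u(3) z] assms t(1) u(1) by simp_all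
  then have "y \<in> dom (\<theta> (u\<^sup>\<star>))" "y \<in> dom (\<theta> (s\<^sup>\<star>))" "y \<in> dom (\<theta> (t\<^sup>\<star>))"
    using action_star assms t(1) by blast+
  then have "germ \<theta> (t\<^sup>\<star>) y = germ \<theta> (s\<^sup>\<star>) y"
    using germ_eq_iff nat_le_star[OF u(2)] nat_le_star[OF u(3)] by blast
  then show "h = germ \<theta> (s\<^sup>\<star>) y"
    using t(3) \<open>y = y'\<close> by simp
qed

lemma germ_mult_germ:
  assumes "\<theta> t y = Some x" "x \<in> dom (\<theta> s)"
  shows "germ_mult \<theta> (germ \<theta> s x) (germ \<theta> t y) = germ \<theta> (s * t) y"
  unfolding germ_mult_def germ_pairs_def dom_star_mult
proof (rule the_equality)
  show "\<exists>s' x' t' y'. (s', x') \<in> {(s, x). x \<in> dom (\<theta> s)} \<and> germ \<theta> s x = germ \<theta> s' x' \<and>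
      (t', y') \<in> {(s, x). x \<in> dom (\<theta> s)} \<and> germ \<theta> t y = germ \<theta> t' y' \<and>
      \<theta> t' y' = Some x' \<and> germ \<theta> (s * t) y = germ \<theta> (s' * t') y'"
    using assms by blast
next
  fix k
  assume "\<exists>s' x' t' y'. (s', x') \<in> {(s, x). x \<in> dom (\<theta> s)} \<and> germ \<theta> s x = germ \<theta> s' x' \<and>
      (t', y') \<in> {(s, x). x \<in> dom (\<theta> s)} \<and> germ \<theta> t y = germ \<theta> t' y' \<and>
      \<theta> t' y' = Some x' \<and> k = germ \<theta> (s' * t') y'"
  then obtain s' x' t' y' where *: "x' \<in> dom (\<theta> s')" "germ \<theta> s x = germ \<theta> s' x'"
      "germ \<theta> t y = germ \<theta> t' y'" "\<theta> t' y' = Some x'" "k = germ \<theta> (s' * t') y'"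
    by blast
  obtain u where u: "x = x'" "u \<preceq> s" "u \<preceq> s'" "x \<in> dom (\<theta> u)"
    using *(2) germ_eq_iff[OF assms(2) *(1)] by blast
  obtain v where v: "y = y'" "v \<preceq> t" "v \<preceq> t'" "y \<in> dom (\<theta> v)"
    using *(3) germ_eq_iff[OF domI[of "\<theta> t", OF assms(1)] domI[of "\<theta> t'", OF *(4)]] by blast
  then obtain z where z: "\<theta> v y = Some z" by blast
  then have "\<theta> v y = Some x"
    using action_nat_le[OF v(2) z] assms(1) by simp
  then have uv: "y \<in> dom (\<theta> (u * v))"
    using u by (auto simp: action_mult)
  have "y \<in> dom (\<theta> (s * t))" "y \<in> dom (\<theta> (s' * t'))"
    using assms *(1,4) v(1) by (auto simp: action_mult)
  then show "k = germ \<theta> (s * t) y"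
    using *(5) v(1) uv germ_eq_iff nat_le_mult[OF u(2) v(2)] nat_le_mult[OF u(3) v(3)] by blast
qed

end

end

theory Submission
  imports Defs
begin

text \<open>
  For a compactly supported \<open>f\<close> on \<open>dom (\<theta> s)\<close> let \<open>\<delta>\<^sub>s f\<close> be the function on the groupoid that
  vanishes off the bisection \<open>(s, dom (\<theta> s))\<close> and sends \<open>[s, x]\<close> to \<open>f x\<close>. These functions span the
  groupoid algebra, and \<open>\<delta>\<^sub>s f * \<delta>\<^sub>t g = \<delta>\<^bsub>st\<^esub> ((f \<circ> \<theta>\<^sub>t) g)\<close>. A homomorphism \<open>\<phi>\<close> therefore restricts
  to a covariant representation, with \<open>\<sigma> s = \<phi> (\<delta>\<^sub>s 1)\<close> and \<open>\<pi>\<close> the restriction of \<open>\<phi>\<close> to the unit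
  space, and is recovered from it by \<open>\<phi> (\<delta>\<^sub>s f) = \<sigma> s * \<pi> f\<close>.

  Conversely, this formula defines a homomorphism as soon as \<open>\<Sum> \<delta>\<^sub>s f\<^sub>s = 0\<close> implies
  \<open>\<Sum> \<sigma> s * \<pi> f\<^sub>s = 0\<close>. If the sum vanishes, every point of the support of \<open>f\<^sub>t\<close> lies in some set
  \<open>{x. [t, x] = [s, x]}\<close> with \<open>s \<noteq> t\<close>. As the groupoid is Hausdorff, these sets are clopen, so \<open>f\<^sub>t\<close>
  can be cut into pieces, each supported in one of them, and each piece can be moved from the
  index \<open>t\<close> to the index \<open>s\<close> without changing either sum; induct on the number of indices.
\<close>


section \<open>Locally constant functions with compact support\<close>

lemma continuous_map_discrete_iff:
  "continuous_map Y (discrete_topology UNIV) f \<longleftrightarrow>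
    (\<forall>y\<in>topspace Y. \<exists>U. openin Y U \<and> y \<in> U \<and> (\<forall>z\<in>U. f z = f y))"
proof
  assume f: "continuous_map Y (discrete_topology UNIV) f"
  show "\<forall>y\<in>topspace Y. \<exists>U. openin Y U \<and> y \<in> U \<and> (\<forall>z\<in>U. f z = f y)"
  proof
    fix y assume "y \<in> topspace Y"
    moreover have "openin Y {z \<in> topspace Y. f z \<in> {f y}}"
      using f by (rule openin_continuous_map_preimage) simp
    ultimately show "\<exists>U. openin Y U \<and> y \<in> U \<and> (\<forall>z\<in>U. f z = f y)" by blast
  qed
next
  assume *: "\<forall>y\<in>topspace Y. \<exists>U. openin Y U \<and> y \<in> U \<and> (\<forall>z\<in>U. f z = f y)"
  have "openin Y {y \<in> topspace Y. f y \<in> V}" for V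
  proof (subst openin_subopen, clarify)
    fix y assume y: "y \<in> topspace Y" "f y \<in> V"
    then obtain U where U: "openin Y U" "y \<in> U" "\<forall>z\<in>U. f z = f y"
      using * by blast
    have "z \<in> {y \<in> topspace Y. f y \<in> V}" if "z \<in> U" for z
      using that U(3)[rule_format, of z] y openin_subset[OF U(1)] by auto
    with U show "\<exists>T. openin Y T \<and> y \<in> T \<and> T \<subseteq> {y \<in> topspace Y. f y \<in> V}" by blast
  qed
  then show "continuous_map Y (discrete_topology UNIV) f"
    by (simp add: continuous_map_def)
qed

lemma closedin_support:
  assumes "continuous_map Y (discrete_topology UNIV) (f :: 'y \<Rightarrow> 'k::zero)"
  shows "closedin Y {y \<in> topspace Y. f y \<noteq> 0}"
  using closedin_continuous_map_preimage[OF assms, of "- {0}"] by simp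

text \<open>A locally constant function is nonzero on a closed subset of the space, so the closure
  in the definition adds nothing. Compact sets lie inside the space, which accounts for vanishing
  outside it.\<close>

lemma cc_functions_iff:
  "f \<in> cc_functions Y \<longleftrightarrow>
    (\<forall>y\<in>topspace Y. \<exists>U. openin Y U \<and> y \<in> U \<and> (\<forall>z\<in>U. f z = f y)) \<and> compactin Y {y. f y \<noteq> 0}"
proof -
  have supp: "compactin Y (Y closure_of {y \<in> topspace Y. f y \<noteq> 0}) \<and> (\<forall>y. y \<notin> topspace Y \<longrightarrow> f y = 0)
      \<longleftrightarrow> compactin Y {y. f y \<noteq> 0}" (is "?L \<longleftrightarrow> ?R")
    if "continuous_map Y (discrete_topology UNIV) f"
  proof -
    have cl: "Y closure_of {y \<in> topspace Y. f y \<noteq> 0} = {y \<in> topspace Y. f y \<noteq> 0}"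
      by (rule closure_of_closedin[OF closedin_support[OF that]])
    have eq: "{y \<in> topspace Y. f y \<noteq> 0} = {y. f y \<noteq> 0} \<longleftrightarrow> (\<forall>y. y \<notin> topspace Y \<longrightarrow> f y = 0)"
      by blast
    show ?thesis
    proof
      assume L: ?L
      then have e: "{y \<in> topspace Y. f y \<noteq> 0} = {y. f y \<noteq> 0}"
        using eq by blast
      show ?R
        using L unfolding cl unfolding e by (rule conjunct1)
    next
      assume R: ?R
      then have e: "{y \<in> topspace Y. f y \<noteq> 0} = {y. f y \<noteq> 0}"
        using compactin_subset_topspace[OF R] by blast
      show ?L
        unfolding cl using R eq e by (intro conjI) simp_all
    qed
  qed
  show ?thesis
    unfolding cc_functions_def mem_Collect_eq continuous_map_discrete_iff[symmetric]
    using supp by (rule conj_cong[OF refl])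
qed

text \<open>Local constancy makes the support closed, and a closed subset of the compact set
  \<open>C\<close> is compact. It is thus enough to bound the support.\<close>

lemma cc_functionsI:
  assumes "\<And>y. y \<in> topspace Y \<Longrightarrow> \<exists>U. openin Y U \<and> y \<in> U \<and> (\<forall>z\<in>U. f z = f y)"
    and "compactin Y C" and "\<And>y. f y \<noteq> 0 \<Longrightarrow> y \<in> C"
  shows "f \<in> cc_functions Y"
proof -
  have C: "C \<subseteq> topspace Y"
    using assms(2) by (rule compactin_subset_topspace)
  have "closedin Y {y \<in> topspace Y. f y \<noteq> 0}"
    using assms(1) by (intro closedin_support) (auto simp: continuous_map_discrete_iff)
  moreover have "{y \<in> topspace Y. f y \<noteq> 0} = {y. f y \<noteq> 0}"
    using assms(3) C by blast
  ultimately have "closedin Y {y. f y \<noteq> 0}"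
    by (simp only:)
  then have "compactin Y {y. f y \<noteq> 0}"
    by (rule closed_compactin[OF assms(2), rotated]) (use assms(3) in blast)
  with assms(1) show ?thesis
    by (simp add: cc_functions_iff)
qed

lemma cc_functions_const:
  assumes "f \<in> cc_functions Y" "y \<in> topspace Y"
  shows "\<exists>U. openin Y U \<and> y \<in> U \<and> (\<forall>z\<in>U. f z = f y)"
  using assms unfolding cc_functions_iff by blast

lemma cc_functions_compact: "f \<in> cc_functions Y \<Longrightarrow> compactin Y {y. f y \<noteq> 0}"
  by (simp add: cc_functions_iff)

lemma cc_functions_zero: "(\<lambda>_. 0) \<in> cc_functions Y"
  unfolding cc_functions_iff by simp (blast intro: openin_topspace)

text \<open>The condition \<open>c 0 0 = 0\<close> keeps the support inside the union of both
  supports. Sums, products and scalar multiples are all instances.\<close>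

lemma cc_functions_combine:
  assumes "f \<in> cc_functions Y" "g \<in> cc_functions Y" "c 0 0 = 0"
  shows "(\<lambda>y. c (f y) (g y)) \<in> cc_functions Y"
proof (rule cc_functionsI)
  fix y assume y: "y \<in> topspace Y"
  obtain U where U: "openin Y U" "y \<in> U" "\<forall>z\<in>U. f z = f y"
    using cc_functions_const[OF assms(1) y] by blast
  obtain V where V: "openin Y V" "y \<in> V" "\<forall>z\<in>V. g z = g y"
    using cc_functions_const[OF assms(2) y] by blast
  have "c (f z) (g z) = c (f y) (g y)" if "z \<in> U \<inter> V" for z
    using that U(3)[rule_format, of z] V(3)[rule_format, of z] by simp
  moreover have "openin Y (U \<inter> V)" "y \<in> U \<inter> V" using U V by blast+
  ultimately show "\<exists>U. openin Y U \<and> y \<in> U \<and> (\<forall>z\<in>U. c (f z) (g z) = c (f y) (g y))" by blast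
next
  show "compactin Y ({y. f y \<noteq> 0} \<union> {y. g y \<noteq> 0})"
    using assms(1,2) by (intro compactin_Un cc_functions_compact)
  show "y \<in> {y. f y \<noteq> 0} \<union> {y. g y \<noteq> 0}" if "c (f y) (g y) \<noteq> 0" for y
    using that assms(3) by auto
qed

lemma cc_functions_add:
  "f \<in> cc_functions Y \<Longrightarrow> g \<in> cc_functions Y \<Longrightarrow> (\<lambda>y. f y + g y) \<in> cc_functions Y"
  by (rule cc_functions_combine[where c = "(+)"]) simp_all

lemma cc_functions_mult:
  "f \<in> cc_functions Y \<Longrightarrow> g \<in> cc_functions Y \<Longrightarrow> pointwise_mult f g \<in> cc_functions Y"
  unfolding pointwise_mult_def by (rule cc_functions_combine[where c = "(*)"]) simp_all

lemma cc_functions_scale: "f \<in> cc_functions Y \<Longrightarrow> (\<lambda>y. c * f y) \<in> cc_functions Y"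
  by (rule cc_functions_combine[where c = "\<lambda>a b. c * a" and g = f]) simp_all

lemma cc_functions_restrict:
  assumes "f \<in> cc_functions Y" "openin Y U" "closedin Y U"
  shows "(\<lambda>y. if y \<in> U then f y else 0) \<in> cc_functions Y"
proof (rule cc_functionsI)
  fix y assume y: "y \<in> topspace Y"
  obtain V where V: "openin Y V" "y \<in> V" "\<forall>z\<in>V. f z = f y"
    using cc_functions_const[OF assms(1) y] by blast
  \<comment> \<open>As \<open>U\<close> is clopen, \<open>V\<close> can be shrunk to one side of it,
    where the cut function is either \<open>f\<close> or 0.\<close>
  define W where "W = (if y \<in> U then V \<inter> U else V - U)"
  have "openin Y W"
    unfolding W_def using V(1) assms(2,3) by (auto intro: openin_diff)
  moreover have "y \<in> W"
    using V(2) by (simp add: W_def)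
  moreover have "(if z \<in> U then f z else 0) = (if y \<in> U then f y else 0)" if "z \<in> W" for z
    using that V(3)[rule_format, of z] by (simp add: W_def split: if_splits)
  ultimately show "\<exists>W. openin Y W \<and> y \<in> W \<and>
      (\<forall>z\<in>W. (if z \<in> U then f z else 0) = (if y \<in> U then f y else 0))" by blast
next
  show "compactin Y {y. f y \<noteq> 0}"
    using assms(1) by (rule cc_functions_compact)
qed (auto split: if_splits)

text \<open>The support lies in the compact set \<open>U\<close>, and the two branches live on
  complementary open sets. It is applied to \<open>germ \<theta> s\<close> and to the partial
  homeomorphisms of the action.\<close>

lemma cc_functions_pullback:
  assumes f: "f \<in> cc_functions Y" and p: "continuous_map (subtopology X U) Y p"
    and U: "openin X U" "closedin X U" "compactin X U"
  shows "(\<lambda>x. if x \<in> U then f (p x) else 0) \<in> cc_functions X"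
proof (rule cc_functionsI[OF _ U(3)])
  fix x assume x: "x \<in> topspace X"
  show "\<exists>W. openin X W \<and> x \<in> W \<and>
      (\<forall>z\<in>W. (if z \<in> U then f (p z) else 0) = (if x \<in> U then f (p x) else 0))"
  proof (cases "x \<in> U")
    case True
    then have "p x \<in> topspace Y"
      using p x by (auto simp: continuous_map_def)
    then obtain V where V: "openin Y V" "p x \<in> V" "\<forall>z\<in>V. f z = f (p x)"
      using cc_functions_const[OF f, of "p x"] by blast
    have "openin (subtopology X U) {z \<in> topspace (subtopology X U). p z \<in> V}"
      using p V(1) by (rule openin_continuous_map_preimage)
    then have "openin X {z \<in> topspace (subtopology X U). p z \<in> V}"
      by (rule openin_trans_full[OF _ U(1)])
    moreover have "x \<in> {z \<in> topspace (subtopology X U). p z \<in> V}"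
      using True x V(2) by simp
    moreover have "(if z \<in> U then f (p z) else 0) = (if x \<in> U then f (p x) else 0)"
      if "z \<in> {z \<in> topspace (subtopology X U). p z \<in> V}" for z
      using that True V(3)[rule_format, of "p z"] by simp
    ultimately show ?thesis by blast
  next
    case False
    have "openin X (topspace X - U)" using U(2) by blast
    then show ?thesis
      using False x by (intro exI[of _ "topspace X - U"]) auto
  qed
qed (auto split: if_splits)

lemma char_fun_cc_functions:
  assumes "openin X U" "closedin X U" "compactin X U"
  shows "char_fun U \<in> cc_functions X"
proof (rule cc_functionsI[OF _ assms(3)])
  fix x assume x: "x \<in> topspace X"
  have "openin X (topspace X - U)" using assms(2) by blast
  then show "\<exists>W. openin X W \<and> x \<in> W \<and> (\<forall>z\<in>W. char_fun U z = char_fun U x)"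
    using assms(1) x
    by (intro exI[of _ "if x \<in> U then U else topspace X - U"]) (auto simp: char_fun_def)
qed (auto simp: char_fun_def split: if_splits)

text \<open>Extension by 0 remains locally constant because the complement of \<open>U\<close> is
  open. Functions on a domain can thus be handled as functions on \<open>X\<close> with a support
  condition.\<close>

lemma cc_functions_subtopology_iff:
  assumes "openin X U" "closedin X U"
  shows "f \<in> cc_functions (subtopology X U) \<longleftrightarrow> f \<in> cc_functions X \<and> (\<forall>x. f x \<noteq> 0 \<longrightarrow> x \<in> U)"
proof
  assume f: "f \<in> cc_functions (subtopology X U)"
  then have supp: "compactin X {x. f x \<noteq> 0}" "{x. f x \<noteq> 0} \<subseteq> U"
    using cc_functions_compact[OF f] by (auto simp: compactin_subtopology)
  have "f \<in> cc_functions X"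
  proof (rule cc_functionsI[OF _ supp(1)])
    fix x assume x: "x \<in> topspace X"
    show "\<exists>W. openin X W \<and> x \<in> W \<and> (\<forall>z\<in>W. f z = f x)"
    proof (cases "x \<in> U")
      case True
      then obtain W where "openin (subtopology X U) W" "x \<in> W" "\<forall>z\<in>W. f z = f x"
        using x cc_functions_const[OF f, of x] by auto
      then show ?thesis
        using openin_trans_full[OF _ assms(1)] by blast
    next
      case False
      have "openin X (topspace X - U)" using assms(2) by blast
      moreover have "f z = f x" if "z \<in> topspace X - U" for z
      proof -
        have "f z = 0" "f x = 0"
          using that False supp(2) by blast+
        then show ?thesis by simp
      qed
      ultimately show ?thesis
        using False x by blast
    qed
  qed simp
  with supp show "f \<in> cc_functions X \<and> (\<forall>x. f x \<noteq> 0 \<longrightarrow> x \<in> U)" by blast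
next
  assume f: "f \<in> cc_functions X \<and> (\<forall>x. f x \<noteq> 0 \<longrightarrow> x \<in> U)"
  then have "compactin (subtopology X U) {x. f x \<noteq> 0}"
    using cc_functions_compact[of f X] by (auto simp: compactin_subtopology)
  then show "f \<in> cc_functions (subtopology X U)"
  proof (rule cc_functionsI[rotated])
    fix x assume x: "x \<in> topspace (subtopology X U)"
    then obtain W where W: "openin X W" "x \<in> W" "\<forall>z\<in>W. f z = f x"
      using f x cc_functions_const[of f X x] by auto
    have "openin (subtopology X U) (U \<inter> W)"
      using W(1) by (rule openin_subtopology_Int2)
    moreover have "x \<in> U \<inter> W"
      using W(2) x by simp
    ultimately show "\<exists>W. openin (subtopology X U) W \<and> x \<in> W \<and> (\<forall>z\<in>W. f z = f x)"
      using W(3) by blast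
  qed simp
qed

text \<open>Compactness of the support leaves finitely many members of the cover. They are removed
  one at a time: each clopen \<open>U\<close> splits the function into its part on \<open>U\<close>,
  covered by \<open>piece\<close>, and a rest supported in the remaining members.\<close>

lemma cc_functions_cover_induct [consumes 2, case_names clopen zero add piece]:
  assumes "a \<in> cc_functions Y" "{y. a y \<noteq> 0} \<subseteq> \<Union>\<U>"
    and clopen: "\<And>U. U \<in> \<U> \<Longrightarrow> openin Y U \<and> closedin Y U"
    and zero: "P (\<lambda>_. 0)"
    and add: "\<And>a b. a \<in> cc_functions Y \<Longrightarrow> b \<in> cc_functions Y \<Longrightarrow> P a \<Longrightarrow> P b \<Longrightarrow>
      P (\<lambda>y. a y + b y)"
    and piece: "\<And>b U. b \<in> cc_functions Y \<Longrightarrow> U \<in> \<U> \<Longrightarrow> (\<And>y. b y \<noteq> 0 \<Longrightarrow> y \<in> U) \<Longrightarrow> P b"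
  shows "P a"
proof -
  obtain \<V> where \<V>: "finite \<V>" "\<V> \<subseteq> \<U>" "{y. a y \<noteq> 0} \<subseteq> \<Union>\<V>"
    using cc_functions_compact[OF assms(1)] assms(2) clopen unfolding compactin_def by meson
  from \<V>(1) show ?thesis
    using \<V>(2,3) assms(1)
  proof (induction arbitrary: a)
    case empty
    then have "a = (\<lambda>_. 0)" by auto
    with zero show ?case by simp
  next
    case (insert U \<V>)
    have U: "openin Y U" "closedin Y U" "U \<in> \<U>"
      using clopen insert.prems(1) by auto
    define b where "b = (\<lambda>y. if y \<in> U then a y else 0)"
    define c where "c = (\<lambda>y. if y \<in> topspace Y - U then a y else 0)"
    have bc: "b \<in> cc_functions Y" "c \<in> cc_functions Y"
      unfolding b_def c_def using U(1,2) insert.prems(3)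
      by (intro cc_functions_restrict; blast)+
    have "P b"
      using bc(1) U(3) by (rule piece) (simp add: b_def split: if_splits)
    moreover have "P c"
      using insert.prems bc(2) by (intro insert.IH) (auto simp: c_def split: if_splits)
    moreover have "a y = b y + c y" for y
      using compactin_subset_topspace[OF cc_functions_compact[OF insert.prems(3)]]
      by (auto simp: b_def c_def)
    ultimately show ?case
      using add[OF bc] by presburger
  qed
qed


section \<open>Functions on the groupoid of germs\<close>

text \<open>This is \<open>\<delta>\<^sub>s f\<close>.\<close>

definition germ_fun ::
    "('s::inverse_semigroup \<Rightarrow> 'x \<rightharpoonup> 'x) \<Rightarrow> 's \<Rightarrow> ('x \<Rightarrow> 'k::{comm_ring, comm_monoid_mult}) \<Rightarrow>
     ('s \<times> 'x) set \<Rightarrow> 'k"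
  where "germ_fun \<theta> s f = (\<lambda>g. if g \<in> germ \<theta> s ` dom (\<theta> s) then f (germ_d \<theta> g) else 0)"

text \<open>The embedding of the functions on \<open>X\<close> into the groupoid algebra, with \<open>X\<close> identified with the
  unit space.\<close>

definition unit_fun ::
    "('s::inverse_semigroup \<Rightarrow> 'x \<rightharpoonup> 'x) \<Rightarrow> ('x \<Rightarrow> 'k::{comm_ring, comm_monoid_mult}) \<Rightarrow>
     ('s \<times> 'x) set \<Rightarrow> 'k"
  where "unit_fun \<theta> f =
    (\<lambda>g. if \<exists>e\<in>idems. g \<in> germ \<theta> e ` dom (\<theta> e) then f (germ_d \<theta> g) else 0)"

text \<open>An element below \<open>s\<close> is \<open>s\<close> restricted to its own domain
  idempotent. With \<open>u = s * e\<close>, this follows since \<open>e\<close> commutes with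
  \<open>s\<^sup>\<star> * s\<close>.\<close>

lemma nat_le_mult_star:
  fixes s u :: "'s::inverse_semigroup"
  assumes "u \<preceq> s"
  shows "s * (u\<^sup>\<star> * u) = u"
proof -
  obtain e where e: "e \<in> idems" "u = s * e"
    using assms nat_le_iff_right by blast
  have "s * (u\<^sup>\<star> * u) = s * (e * (s\<^sup>\<star> * s)) * e"
    using e star_idem[OF e(1)] by (simp add: star_mult mult.assoc)
  also have "e * (s\<^sup>\<star> * s) = s\<^sup>\<star> * s * e"
    by (rule idem_commute[OF e(1) star_mult_idem(1)])
  also have "s * (s\<^sup>\<star> * s * e) * e = (s * s\<^sup>\<star> * s) * (e * e)"
    by (simp add: mult.assoc)
  finally show ?thesis
    using e by (simp add: star_inverse idems_def)
qed

locale ample_germs =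
  fixes X :: "'x topology" and \<theta> :: "'s::inverse_semigroup \<Rightarrow> 'x \<rightharpoonup> 'x"
  assumes ample: "ample_action X \<theta>"
    and Hausdorff_germs: "Hausdorff_space (germ_topology X \<theta>)"
begin

lemma act: "semigroup_action X \<theta>"
  using ample by (simp add: ample_action_def)

abbreviation germ_space ("\<G>")
  where "\<G> \<equiv> germ_topology X \<theta>"

abbreviation cc_dom :: "'s \<Rightarrow> ('x \<Rightarrow> 'k::{comm_ring, comm_monoid_mult}) set"
  where "cc_dom s \<equiv> cc_functions (subtopology X (dom (\<theta> s)))"

lemma Hausdorff_X: "Hausdorff_space X"
  using ample by (simp add: ample_action_def)

text \<open>Ampleness speaks of idempotents only; compactness carries over to all \<open>s\<close>
  because \<open>s\<close> and \<open>s\<^sup>\<star> * s\<close> have the same domain.\<close>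

lemma dom_clopen: "openin X (dom (\<theta> s))" "closedin X (dom (\<theta> s))" "compactin X (dom (\<theta> s))"
proof -
  show "compactin X (dom (\<theta> s))"
    using ample star_mult_idem(1)[of s] unfolding ample_action_def dom_star_mult[OF act, symmetric, of s]
    by blast
  then show "closedin X (dom (\<theta> s))"
    by (rule compactin_imp_closedin[OF Hausdorff_X])
  show "openin X (dom (\<theta> s))"
    by (rule openin_dom_action[OF act])
qed

lemma topspace_dom: "topspace (subtopology X (dom (\<theta> s))) = dom (\<theta> s)"
  using openin_subset[OF dom_clopen(1)[of s]] by auto

lemma topspace_X: "topspace X = (\<Union>e\<in>idems. dom (\<theta> e))"
  using ample by (simp add: ample_action_def nondegenerate_action_def)

lemma cc_dom_iff: "f \<in> cc_dom s \<longleftrightarrow> f \<in> cc_functions X \<and> (\<forall>x. f x \<noteq> 0 \<longrightarrow> x \<in> dom (\<theta> s))"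
  by (rule cc_functions_subtopology_iff[OF dom_clopen(1,2)])

lemma dom_mult: "y \<in> dom (\<theta> (s * t)) \<longleftrightarrow> (\<exists>x. \<theta> t y = Some x \<and> x \<in> dom (\<theta> s))"
  by (auto simp: action_mult[OF act] split: option.splits)

lemma dom_nat_le: "u \<preceq> s \<Longrightarrow> dom (\<theta> u) \<subseteq> dom (\<theta> s)"
  using action_nat_le[OF act] by fast

lemma germ_eq: "u \<preceq> s \<Longrightarrow> x \<in> dom (\<theta> u) \<Longrightarrow> germ \<theta> u x = germ \<theta> s x"
  using germ_eq_iff[OF act, of x u x s] dom_nat_le nat_le_refl by blast

section \<open>Compact open bisections of the groupoid of germs\<close>

lemma openin_germ_image:
  assumes "openin X U" "U \<subseteq> dom (\<theta> s)"
  shows "openin \<G> (germ \<theta> s ` U)"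
proof -
  have "germ \<theta> s ` U \<in> germ_basis X \<theta>"
    using assms unfolding germ_basis_def dom_star_mult[OF act] by blast
  then show ?thesis
    unfolding openin_germ_topology[OF act] by (rule arbitrary_union_of_inc)
qed

lemma in_germs: "x \<in> dom (\<theta> s) \<Longrightarrow> germ \<theta> s x \<in> germs \<theta>"
  unfolding germs_def germ_def by (rule quotientI) (simp add: germ_pairs_def dom_star_mult[OF act])

lemma germsE:
  assumes "g \<in> germs \<theta>"
  obtains s x where "x \<in> dom (\<theta> s)" "g = germ \<theta> s x"
proof -
  obtain p where "p \<in> germ_pairs \<theta>" "g = germ_rel \<theta> `` {p}"
    using assms unfolding germs_def by (rule quotientE)
  then show thesis
    using that[of "snd p" "fst p"] by (simp add: germ_def germ_pairs_def dom_star_mult[OF act] split_beta)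
qed

text \<open>Equality of the germs at \<open>x\<close> is witnessed by a common lower bound
  \<open>u\<close> defined at \<open>x\<close>, so the set is a union of open domains.\<close>

lemma openin_germ_eq: "openin X {x \<in> dom (\<theta> s) \<inter> dom (\<theta> t). germ \<theta> s x = germ \<theta> t x}"
proof -
  have "{x \<in> dom (\<theta> s) \<inter> dom (\<theta> t). germ \<theta> s x = germ \<theta> t x} =
      (\<Union>u\<in>{u. u \<preceq> s \<and> u \<preceq> t}. dom (\<theta> u))"
  proof (intro equalityI subsetI)
    fix x assume "x \<in> {x \<in> dom (\<theta> s) \<inter> dom (\<theta> t). germ \<theta> s x = germ \<theta> t x}"
    then show "x \<in> (\<Union>u\<in>{u. u \<preceq> s \<and> u \<preceq> t}. dom (\<theta> u))"
      using germ_eq_iff[OF act, of x s x t] by blast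
  next
    fix x assume "x \<in> (\<Union>u\<in>{u. u \<preceq> s \<and> u \<preceq> t}. dom (\<theta> u))"
    then obtain u where u: "u \<preceq> s" "u \<preceq> t" "x \<in> dom (\<theta> u)" by blast
    then have "germ \<theta> s x = germ \<theta> t x"
      using germ_eq[of u s x] germ_eq[of u t x] by simp
    then show "x \<in> {x \<in> dom (\<theta> s) \<inter> dom (\<theta> t). germ \<theta> s x = germ \<theta> t x}"
      using u dom_nat_le by blast
  qed
  then show ?thesis
    using dom_clopen(1) by auto
qed

text \<open>If \<open>germ \<theta> s x\<close> lies in a basic set given by \<open>t\<close>, then
  \<open>s\<close> and \<open>t\<close> have equal germs on a whole neighbourhood of
  \<open>x\<close>, by \<open>openin_germ_eq\<close>.\<close>

lemma continuous_germ: "continuous_map (subtopology X (dom (\<theta> s))) \<G> (germ \<theta> s)"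
  unfolding continuous_map_def topspace_dom topspace_germ_topology[OF act]
proof (intro conjI allI impI)
  show "germ \<theta> s \<in> dom (\<theta> s) \<rightarrow> germs \<theta>"
    using in_germs by blast
  fix W assume W: "openin \<G> W"
  have "openin X {x \<in> dom (\<theta> s). germ \<theta> s x \<in> W}"
  proof (subst openin_subopen, clarify)
    fix x y assume x: "\<theta> s x = Some y" "germ \<theta> s x \<in> W"
    then obtain B where B: "B \<in> germ_basis X \<theta>" "germ \<theta> s x \<in> B" "B \<subseteq> W"
      using W unfolding openin_germ_topology[OF act] arbitrary_union_of_alt by blast
    then obtain t U where U: "B = germ \<theta> t ` U" "openin X U" "U \<subseteq> dom (\<theta> t)"
      unfolding germ_basis_def dom_star_mult[OF act] by blast
    then obtain z where z: "z \<in> U" "germ \<theta> s x = germ \<theta> t z"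
      using B by blast
    then have "x = z"
      using germ_eq_iff[OF act, of x s z t] U x by blast
    let ?T = "U \<inter> {x \<in> dom (\<theta> s) \<inter> dom (\<theta> t). germ \<theta> s x = germ \<theta> t x}"
    have "openin X ?T"
      using U(2) openin_germ_eq by blast
    moreover have "x \<in> ?T"
      using x z U(3) \<open>x = z\<close> by auto
    moreover have "?T \<subseteq> {x \<in> dom (\<theta> s). germ \<theta> s x \<in> W}"
      using B(3) U(1) by auto
    ultimately show "\<exists>T. openin X T \<and> x \<in> T \<and> T \<subseteq> {x \<in> dom (\<theta> s). germ \<theta> s x \<in> W}"
      by blast
  qed
  then show "openin (subtopology X (dom (\<theta> s))) {x \<in> dom (\<theta> s). germ \<theta> s x \<in> W}"
    using openin_subtopology_Int2[of X _ "dom (\<theta> s)"] by (simp add: openin_open_subtopology dom_clopen(1))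
qed

text \<open>The bisection is compact as the continuous image of a compact domain. It is closed
  because the groupoid is Hausdorff.\<close>

lemma germ_image_clopen:
  "openin \<G> (germ \<theta> s ` dom (\<theta> s))" "closedin \<G> (germ \<theta> s ` dom (\<theta> s))"
  "compactin \<G> (germ \<theta> s ` dom (\<theta> s))"
proof -
  show "openin \<G> (germ \<theta> s ` dom (\<theta> s))"
    using openin_germ_image dom_clopen(1) by blast
  show "compactin \<G> (germ \<theta> s ` dom (\<theta> s))"
    using dom_clopen(3) by (intro image_compactin[OF _ continuous_germ]) (simp add: compactin_subtopology)
  then show "closedin \<G> (germ \<theta> s ` dom (\<theta> s))"
    by (rule compactin_imp_closedin[OF Hausdorff_germs])
qed

text \<open>This is the preimage under \<open>germ \<theta> s\<close> of the bisection of
  \<open>t\<close>, which is closed by Hausdorffness. Functions can therefore be cut along agreement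
  sets.\<close>

lemma closedin_germ_eq: "closedin X {x \<in> dom (\<theta> s) \<inter> dom (\<theta> t). germ \<theta> s x = germ \<theta> t x}"
proof -
  have "closedin (subtopology X (dom (\<theta> s)))
      {x \<in> topspace (subtopology X (dom (\<theta> s))). germ \<theta> s x \<in> germ \<theta> t ` dom (\<theta> t)}"
    by (rule closedin_continuous_map_preimage[OF continuous_germ germ_image_clopen(2)])
  moreover have "{x \<in> topspace (subtopology X (dom (\<theta> s))). germ \<theta> s x \<in> germ \<theta> t ` dom (\<theta> t)} =
      {x \<in> dom (\<theta> s) \<inter> dom (\<theta> t). germ \<theta> s x = germ \<theta> t x}"
    unfolding topspace_dom using germ_eq_iff[OF act] by blast
  ultimately show ?thesis
    using closedin_trans_full dom_clopen(2) by metis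
qed

section \<open>Functions supported on one bisection, and the induction principles they give\<close>

lemma germ_fun_germ:
  assumes "y \<in> dom (\<theta> r)"
  shows "germ_fun \<theta> s f (germ \<theta> r y) =
    (if y \<in> dom (\<theta> s) \<and> germ \<theta> s y = germ \<theta> r y then f y else 0)"
proof -
  have "germ \<theta> r y \<in> germ \<theta> s ` dom (\<theta> s) \<longleftrightarrow> y \<in> dom (\<theta> s) \<and> germ \<theta> s y = germ \<theta> r y"
  proof
    assume "germ \<theta> r y \<in> germ \<theta> s ` dom (\<theta> s)"
    then obtain x where x: "x \<in> dom (\<theta> s)" "germ \<theta> r y = germ \<theta> s x" by blast
    then have "y = x"
      using germ_eq_iff[OF act assms x(1)] by blast
    with x show "y \<in> dom (\<theta> s) \<and> germ \<theta> s y = germ \<theta> r y" by simp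
  next
    assume "y \<in> dom (\<theta> s) \<and> germ \<theta> s y = germ \<theta> r y"
    then show "germ \<theta> r y \<in> germ \<theta> s ` dom (\<theta> s)" by (metis imageI)
  qed
  then show ?thesis
    using germ_d_germ[OF act assms] by (simp add: germ_fun_def)
qed

lemma germ_fun_nonzero:
  assumes "germ_fun \<theta> s f h \<noteq> 0"
  shows "germ_d \<theta> h \<in> dom (\<theta> s)" "h = germ \<theta> s (germ_d \<theta> h)"
proof -
  obtain x where x: "x \<in> dom (\<theta> s)" "h = germ \<theta> s x"
    using assms unfolding germ_fun_def by (auto split: if_splits)
  then show "germ_d \<theta> h \<in> dom (\<theta> s)" "h = germ \<theta> s (germ_d \<theta> h)"
    using germ_d_germ[OF act x(1)] by simp_all
qed

lemma germ_fun_outside: "g \<notin> germs \<theta> \<Longrightarrow> germ_fun \<theta> s f g = 0"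
  using in_germs by (auto simp: germ_fun_def)

lemma germ_function_eqI:
  assumes "\<And>g. g \<notin> germs \<theta> \<Longrightarrow> a g = b g" "\<And>r y. y \<in> dom (\<theta> r) \<Longrightarrow> a (germ \<theta> r y) = b (germ \<theta> r y)"
  shows "a = b"
proof
  fix g show "a g = b g"
  proof (cases "g \<in> germs \<theta>")
    case True
    then show ?thesis
      by (rule germsE) (simp add: assms(2))
  qed (rule assms(1))
qed

lemma germ_fun_cc:
  assumes "f \<in> cc_dom s"
  shows "germ_fun \<theta> s f \<in> cc_functions \<G>"
proof (rule cc_functionsI[OF _ germ_image_clopen(3)])
  fix g assume g: "g \<in> topspace \<G>"
  show "\<exists>W. openin \<G> W \<and> g \<in> W \<and> (\<forall>h\<in>W. germ_fun \<theta> s f h = germ_fun \<theta> s f g)"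
  proof (cases "g \<in> germ \<theta> s ` dom (\<theta> s)")
    case True
    then obtain x where x: "x \<in> dom (\<theta> s)" "g = germ \<theta> s x" by blast
    then obtain U where U: "openin (subtopology X (dom (\<theta> s))) U" "x \<in> U" "\<forall>z\<in>U. f z = f x"
      using cc_functions_const[OF assms, of x] unfolding topspace_dom by blast
    have UX: "openin X U" "U \<subseteq> dom (\<theta> s)"
      using openin_trans_full[OF U(1) dom_clopen(1)] openin_subset[OF U(1)] topspace_dom by auto
    have "germ_fun \<theta> s f (germ \<theta> s z) = germ_fun \<theta> s f g" if "z \<in> U" for z
      using that UX(2) x U(3)[rule_format, OF that] by (simp add: germ_fun_germ subset_iff)
    then show ?thesis
      using openin_germ_image[OF UX] U(2) x(2) by blast
  next
    case False
    have "openin \<G> (topspace \<G> - germ \<theta> s ` dom (\<theta> s))"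
      using germ_image_clopen(2) by blast
    moreover have "germ_fun \<theta> s f h = germ_fun \<theta> s f g"
      if "h \<in> topspace \<G> - germ \<theta> s ` dom (\<theta> s)" for h
      using that False by (simp add: germ_fun_def)
    ultimately show ?thesis
      using False g by blast
  qed
qed (auto simp: germ_fun_def split: if_splits)

text \<open>The clopen bisections cover the groupoid. A function supported on the bisection of
  \<open>s\<close> is \<open>germ_fun \<theta> s f\<close> for \<open>f\<close> its pullback along
  \<open>germ \<theta> s\<close>, so functions of this form span.\<close>

lemma cc_germ_induct [consumes 1, case_names zero add germ_fun]:
  assumes "a \<in> cc_functions \<G>"
    and zero: "P (\<lambda>_. 0)"
    and add: "\<And>a b. a \<in> cc_functions \<G> \<Longrightarrow> b \<in> cc_functions \<G> \<Longrightarrow> P a \<Longrightarrow> P b \<Longrightarrow>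
      P (\<lambda>g. a g + b g)"
    and germ_fun: "\<And>s f. f \<in> cc_dom s \<Longrightarrow> P (germ_fun \<theta> s f)"
  shows "P a"
proof -
  have "g \<in> \<Union> (range (\<lambda>s. germ \<theta> s ` dom (\<theta> s)))" if "a g \<noteq> 0" for g
  proof -
    have "g \<in> germs \<theta>"
      using that compactin_subset_topspace[OF cc_functions_compact[OF assms(1)]]
      unfolding topspace_germ_topology[OF act] by blast
    then obtain s x where "x \<in> dom (\<theta> s)" "g = germ \<theta> s x"
      by (rule germsE)
    then show ?thesis by blast
  qed
  then have "{g. a g \<noteq> 0} \<subseteq> \<Union> (range (\<lambda>s. germ \<theta> s ` dom (\<theta> s)))" by blast
  with assms(1) show ?thesis
  proof (induction rule: cc_functions_cover_induct)
    case (piece b U)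
    then obtain s where s: "U = germ \<theta> s ` dom (\<theta> s)" by blast
    define f where "f = (\<lambda>x. if x \<in> dom (\<theta> s) then b (germ \<theta> s x) else 0)"
    have "f \<in> cc_functions X"
      unfolding f_def by (rule cc_functions_pullback[OF piece(1) continuous_germ dom_clopen])
    then have "f \<in> cc_dom s"
      unfolding cc_dom_iff by (simp add: f_def)
    moreover have "b = germ_fun \<theta> s f"
    proof
      fix g show "b g = germ_fun \<theta> s f g"
        using piece(3)[of g] unfolding s
        by (auto simp: germ_fun_def f_def germ_d_germ[OF act] domI)
    qed
    ultimately show ?case
      using germ_fun by simp
  qed (use zero add germ_image_clopen in auto)
qed

text \<open>Non-degeneracy says that the clopen domains of the idempotents cover
  \<open>X\<close>.\<close>

lemma cc_X_induct [consumes 1, case_names zero add idem]: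
  assumes "f \<in> cc_functions X"
    and zero: "P (\<lambda>_. 0)"
    and add: "\<And>f g. f \<in> cc_functions X \<Longrightarrow> g \<in> cc_functions X \<Longrightarrow> P f \<Longrightarrow> P g \<Longrightarrow>
      P (\<lambda>x. f x + g x)"
    and idem: "\<And>e f. e \<in> idems \<Longrightarrow> f \<in> cc_dom e \<Longrightarrow> P f"
  shows "P f"
proof -
  have "{x. f x \<noteq> 0} \<subseteq> \<Union> ((\<lambda>e. dom (\<theta> e)) ` idems)"
    using compactin_subset_topspace[OF cc_functions_compact[OF assms(1)]] topspace_X by simp
  with assms(1) show ?thesis
  proof (induction rule: cc_functions_cover_induct)
    case (piece b U)
    then show ?case
      using idem cc_dom_iff by blast
  qed (use zero add dom_clopen in auto)
qed

text \<open>Translation by \<open>s\<close> is the pullback along the continuous map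
  \<open>\<theta> (s\<^sup>\<star>)\<close>. The support of \<open>f\<close> is not confined to
  \<open>dom (\<theta> s)\<close>, which lets \<open>pi_sigma\<close> treat arbitrary functions on
  \<open>X\<close>.\<close>

lemma translate_cc:
  assumes "f \<in> cc_functions X"
  shows "translate \<theta> s f \<in> cc_dom (s\<^sup>\<star>)"
proof -
  have dom: "dom (\<theta> (s * s\<^sup>\<star>)) = dom (\<theta> (s\<^sup>\<star>))"
    using dom_star_mult[OF act, of "s\<^sup>\<star>"] by (simp add: star_star)
  have "homeomorphic_map (subtopology X (dom (\<theta> (s\<^sup>\<star>)))) (subtopology X (ran (\<theta> (s\<^sup>\<star>))))
      (\<lambda>x. the (\<theta> (s\<^sup>\<star>) x))"
    using act unfolding semigroup_action_def partial_homeos_def by blast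
  then have "continuous_map (subtopology X (dom (\<theta> (s\<^sup>\<star>)))) X (\<lambda>x. the (\<theta> (s\<^sup>\<star>) x))"
    using homeomorphic_imp_continuous_map continuous_map_into_fulltopology by blast
  from cc_functions_pullback[OF assms this dom_clopen]
  have "translate \<theta> s f \<in> cc_functions X"
    unfolding translate_def dom .
  then show ?thesis
    unfolding cc_dom_iff by (auto simp: translate_def dom split: if_splits)
qed


section \<open>Convolution\<close>

lemma finite_fibre:
  assumes "a \<in> cc_functions \<G>"
  shows "finite {h \<in> germs \<theta>. germ_d \<theta> h = x \<and> a h \<noteq> 0}"
  using assms
proof (induction rule: cc_germ_induct)
  case (add a b)
  have "{h \<in> germs \<theta>. germ_d \<theta> h = x \<and> a h + b h \<noteq> 0} \<subseteq>
      {h \<in> germs \<theta>. germ_d \<theta> h = x \<and> a h \<noteq> 0} \<union> {h \<in> germs \<theta>. germ_d \<theta> h = x \<and> b h \<noteq> 0}"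
    by auto
  then show ?case
    using add.IH by (meson finite_UnI finite_subset)
next
  case (germ_fun s f)
  \<comment> \<open>A bisection meets each fibre of \<open>germ_d\<close> in at most one
    germ.\<close>
  have "h = germ \<theta> s x" if "germ_d \<theta> h = x" "germ_fun \<theta> s f h \<noteq> 0" for h
    using germ_fun_nonzero(2)[OF that(2)] that(1) by simp
  then have "{h \<in> germs \<theta>. germ_d \<theta> h = x \<and> germ_fun \<theta> s f h \<noteq> 0} \<subseteq> {germ \<theta> s x}" by blast
  then show ?case
    by (rule finite_subset) simp
qed simp

text \<open>The index set in the definition varies with both factors. A fixed finite set containing
  the support of \<open>b\<close> in the fibre allows convolutions to be added termwise.\<close>

lemma convolution_eq_sum:
  assumes "g \<in> germs \<theta>" "finite H" "H \<subseteq> {h \<in> germs \<theta>. germ_d \<theta> h = germ_d \<theta> g}"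
    and "\<And>h. h \<in> germs \<theta> \<Longrightarrow> germ_d \<theta> h = germ_d \<theta> g \<Longrightarrow> b h \<noteq> 0 \<Longrightarrow> h \<in> H"
  shows "convolution \<theta> a b g = (\<Sum>h\<in>H. a (germ_mult \<theta> g (germ_inv \<theta> h)) * b h)"
proof -
  have "(\<Sum>h | h \<in> germs \<theta> \<and> germ_d \<theta> h = germ_d \<theta> g \<and>
             a (germ_mult \<theta> g (germ_inv \<theta> h)) * b h \<noteq> 0.
         a (germ_mult \<theta> g (germ_inv \<theta> h)) * b h) =
      (\<Sum>h\<in>H. a (germ_mult \<theta> g (germ_inv \<theta> h)) * b h)"
  proof (rule sum.mono_neutral_left[OF assms(2)])
    show "{h. h \<in> germs \<theta> \<and> germ_d \<theta> h = germ_d \<theta> g \<and>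
        a (germ_mult \<theta> g (germ_inv \<theta> h)) * b h \<noteq> 0} \<subseteq> H"
    proof clarify
      fix h
      assume h: "h \<in> germs \<theta>" "germ_d \<theta> h = germ_d \<theta> g"
        and nz: "a (germ_mult \<theta> g (germ_inv \<theta> h)) * b h \<noteq> 0"
      from nz have "b h \<noteq> 0"
        by (metis mult_zero_right)
      with h show "h \<in> H"
        by (rule assms(4))
    qed
    show "\<forall>h\<in>H - {h. h \<in> germs \<theta> \<and> germ_d \<theta> h = germ_d \<theta> g \<and>
        a (germ_mult \<theta> g (germ_inv \<theta> h)) * b h \<noteq> 0}.
        a (germ_mult \<theta> g (germ_inv \<theta> h)) * b h = 0"
    proof
      fix h assume h: "h \<in> H - {h. h \<in> germs \<theta> \<and> germ_d \<theta> h = germ_d \<theta> g \<and>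
        a (germ_mult \<theta> g (germ_inv \<theta> h)) * b h \<noteq> 0}"
      then have "h \<in> germs \<theta> \<and> germ_d \<theta> h = germ_d \<theta> g"
        using assms(3) by blast
      with h show "a (germ_mult \<theta> g (germ_inv \<theta> h)) * b h = 0" by blast
    qed
  qed
  then show ?thesis
    using assms(1) by (simp add: convolution_def)
qed

lemma convolution_outside: "g \<notin> germs \<theta> \<Longrightarrow> convolution \<theta> a b g = 0"
  by (simp add: convolution_def)

lemma convolution_zero_left: "convolution \<theta> (\<lambda>_. 0) b = (\<lambda>_. 0)"
  by (rule ext) (simp add: convolution_def)

lemma convolution_zero_right: "convolution \<theta> a (\<lambda>_. 0) = (\<lambda>_. 0)"
  by (rule ext) (simp add: convolution_def)

lemma convolution_add_left:
  assumes "b \<in> cc_functions \<G>"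
  shows "convolution \<theta> (\<lambda>g. a g + a' g) b = (\<lambda>g. convolution \<theta> a b g + convolution \<theta> a' b g)"
proof
  fix g
  show "convolution \<theta> (\<lambda>g. a g + a' g) b g = convolution \<theta> a b g + convolution \<theta> a' b g"
  proof (cases "g \<in> germs \<theta>")
    case True
    let ?H = "{h \<in> germs \<theta>. germ_d \<theta> h = germ_d \<theta> g \<and> b h \<noteq> 0}"
    have *: "convolution \<theta> c b g = (\<Sum>h\<in>?H. c (germ_mult \<theta> g (germ_inv \<theta> h)) * b h)" for c
      by (rule convolution_eq_sum[OF True finite_fibre[OF assms]]) blast+
    show ?thesis
      unfolding * by (simp add: distrib_right sum.distrib)
  qed (simp add: convolution_outside)
qed

lemma convolution_add_right:
  assumes "b \<in> cc_functions \<G>" "b' \<in> cc_functions \<G>"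
  shows "convolution \<theta> a (\<lambda>g. b g + b' g) = (\<lambda>g. convolution \<theta> a b g + convolution \<theta> a b' g)"
proof
  fix g
  show "convolution \<theta> a (\<lambda>g. b g + b' g) g = convolution \<theta> a b g + convolution \<theta> a b' g"
  proof (cases "g \<in> germs \<theta>")
    case True
    \<comment> \<open>One index set that serves \<open>b\<close>, \<open>b'\<close> and their
      sum.\<close>
    let ?H = "{h \<in> germs \<theta>. germ_d \<theta> h = germ_d \<theta> g \<and> b h \<noteq> 0} \<union>
      {h \<in> germs \<theta>. germ_d \<theta> h = germ_d \<theta> g \<and> b' h \<noteq> 0}"
    have H: "finite ?H"
      using finite_fibre assms by blast
    have *: "convolution \<theta> a c g = (\<Sum>h\<in>?H. a (germ_mult \<theta> g (germ_inv \<theta> h)) * c h)"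
      if "\<And>h. b h = 0 \<Longrightarrow> b' h = 0 \<Longrightarrow> c h = 0" for c
      by (rule convolution_eq_sum[OF True H]) (use that in blast)+
    show ?thesis
      by (subst (1 2 3) *) (simp_all add: distrib_left sum.distrib)
  qed (simp add: convolution_outside)
qed

text \<open>The germ of \<open>r * t\<^sup>\<star>\<close> at \<open>z\<close> is
  \<open>[r, y][t, y]\<close> with the second factor inverted. Multiplying on the right by
  \<open>[t, y]\<close>, or by its inverse, turns one equation into the other, since
  \<open>r * t\<^sup>\<star> * t\<close> lies below \<open>r\<close> and
  \<open>s * t * t\<^sup>\<star>\<close> below \<open>s\<close>.\<close>

lemma germ_mult_inv_eq_iff:
  assumes y: "\<theta> t y = Some z" "y \<in> dom (\<theta> r)" and z: "z \<in> dom (\<theta> s)"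
  shows "germ \<theta> s z = germ \<theta> (r * t\<^sup>\<star>) z \<longleftrightarrow> germ \<theta> (s * t) y = germ \<theta> r y"
proof
  have ty: "\<theta> (t\<^sup>\<star>) z = Some y"
    by (rule action_star[OF act y(1)])
  have rt: "z \<in> dom (\<theta> (r * t\<^sup>\<star>))"
    using ty y(2) by (auto simp: dom_mult)
  {
    assume *: "germ \<theta> s z = germ \<theta> (r * t\<^sup>\<star>) z"
    have "germ \<theta> (s * t) y = germ \<theta> (r * t\<^sup>\<star> * t) y"
      using germ_mult_germ[OF act y(1) z] germ_mult_germ[OF act y(1) rt] * by simp
    also have "\<dots> = germ \<theta> r y"
    proof (rule germ_eq)
      show "r * t\<^sup>\<star> * t \<preceq> r"
        using star_mult_idem(1)[of t] unfolding nat_le_iff_right mult.assoc by blast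
      show "y \<in> dom (\<theta> (r * t\<^sup>\<star> * t))"
        using rt y(1) by (auto simp: dom_mult[of y "r * t\<^sup>\<star>"])
    qed
    finally show "germ \<theta> (s * t) y = germ \<theta> r y" .
  next
    assume *: "germ \<theta> (s * t) y = germ \<theta> r y"
    have st: "y \<in> dom (\<theta> (s * t))"
      using y(1) z by (auto simp: dom_mult)
    have "germ \<theta> (r * t\<^sup>\<star>) z = germ \<theta> (s * t * t\<^sup>\<star>) z"
      using germ_mult_germ[OF act ty st] germ_mult_germ[OF act ty y(2)] * by simp
    also have "\<dots> = germ \<theta> s z"
    proof (rule germ_eq)
      show "s * t * t\<^sup>\<star> \<preceq> s"
        using star_mult_idem(2)[of t] unfolding nat_le_iff_right mult.assoc by blast
      show "z \<in> dom (\<theta> (s * t * t\<^sup>\<star>))"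
        using st ty by (auto simp: dom_mult[of z "s * t"])
    qed
    finally show "germ \<theta> s z = germ \<theta> (r * t\<^sup>\<star>) z" by simp
  }
qed

lemma translate_star_apply:
  "translate \<theta> (t\<^sup>\<star>) f y = (case \<theta> t y of None \<Rightarrow> 0 | Some z \<Rightarrow> f z)"
  using dom_star_mult[OF act, of t]
  by (auto simp: translate_def star_star dom_def split: option.splits)

text \<open>At \<open>[r, y]\<close> only the term for \<open>[t, y]\<close> can be nonzero, and by
  \<open>germ_mult_inv_eq_iff\<close> the first factor is read off the bisection of \<open>s\<close>
  exactly when \<open>[r, y] = [s * t, y]\<close>. The function
  \<open>translate \<theta> (t\<^sup>\<star>) f\<close> is \<open>f\<close> composed with \<theta>
  at \<open>t\<close>.\<close>

lemma convolution_germ_fun: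
  assumes "\<And>x. f x \<noteq> 0 \<Longrightarrow> x \<in> dom (\<theta> s)" "\<And>x. f' x \<noteq> 0 \<Longrightarrow> x \<in> dom (\<theta> t)"
  shows "convolution \<theta> (germ_fun \<theta> s f) (germ_fun \<theta> t f') =
    germ_fun \<theta> (s * t) (pointwise_mult (translate \<theta> (t\<^sup>\<star>) f) f')"
proof (rule germ_function_eqI)
  fix r y assume r: "y \<in> dom (\<theta> r)"
  have d: "germ_d \<theta> (germ \<theta> r y) = y"
    by (rule germ_d_germ[OF act r])
  show "convolution \<theta> (germ_fun \<theta> s f) (germ_fun \<theta> t f') (germ \<theta> r y) =
    germ_fun \<theta> (s * t) (pointwise_mult (translate \<theta> (t\<^sup>\<star>) f) f') (germ \<theta> r y)"
  proof (cases "\<theta> t y")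
    case None
    have "germ_fun \<theta> t f' h = 0" if "germ_d \<theta> h = y" for h
      using that None germ_fun_nonzero(1)[of t f' h] by auto
    then have "convolution \<theta> (germ_fun \<theta> s f) (germ_fun \<theta> t f') (germ \<theta> r y) = 0"
      using d by (subst convolution_eq_sum[OF in_germs[OF r], of "{}"]) auto
    moreover have "y \<notin> dom (\<theta> (s * t))"
      using None by (simp add: dom_mult)
    ultimately show ?thesis
      by (simp add: germ_fun_germ[OF r])
  next
    case (Some z)
    then have t: "y \<in> dom (\<theta> t)" by blast
    have ty: "\<theta> (t\<^sup>\<star>) z = Some y"
      by (rule action_star[OF act Some])
    have rt: "z \<in> dom (\<theta> (r * t\<^sup>\<star>))"
      using ty r by (auto simp: dom_mult)
    have "h = germ \<theta> t y" if "germ_d \<theta> h = y" "germ_fun \<theta> t f' h \<noteq> 0" for h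
      using germ_fun_nonzero(2)[OF that(2)] that(1) by simp
    then have "convolution \<theta> (germ_fun \<theta> s f) (germ_fun \<theta> t f') (germ \<theta> r y) =
        germ_fun \<theta> s f (germ_mult \<theta> (germ \<theta> r y) (germ_inv \<theta> (germ \<theta> t y))) *
          germ_fun \<theta> t f' (germ \<theta> t y)"
      using d germ_d_germ[OF act t] in_germs[OF t]
      by (subst convolution_eq_sum[OF in_germs[OF r], of "{germ \<theta> t y}"]) simp_all
    also have "germ_mult \<theta> (germ \<theta> r y) (germ_inv \<theta> (germ \<theta> t y)) = germ \<theta> (r * t\<^sup>\<star>) z"
      unfolding germ_inv_germ[OF act Some] by (rule germ_mult_germ[OF act ty r])
    also have "germ_fun \<theta> s f (germ \<theta> (r * t\<^sup>\<star>) z) * germ_fun \<theta> t f' (germ \<theta> t y) =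
        germ_fun \<theta> (s * t) (pointwise_mult (translate \<theta> (t\<^sup>\<star>) f) f') (germ \<theta> r y)"
      using germ_mult_inv_eq_iff[OF Some r, of s] Some
      by (cases "z \<in> dom (\<theta> s)") (simp_all add: germ_fun_germ[OF rt] germ_fun_germ[OF r]
          germ_fun_germ[OF t] t dom_mult pointwise_mult_def translate_star_apply)
    finally show ?thesis .
  qed
qed (simp_all add: convolution_outside germ_fun_outside)

section \<open>The function algebra of the unit space inside the groupoid algebra\<close>

lemma germ_fun_add: "germ_fun \<theta> s (\<lambda>x. f x + f' x) g = germ_fun \<theta> s f g + germ_fun \<theta> s f' g"
  by (simp add: germ_fun_def)

lemma germ_fun_scale: "germ_fun \<theta> s (\<lambda>x. c * f x) g = c * germ_fun \<theta> s f g"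
  by (simp add: germ_fun_def)

lemma unit_fun_add: "unit_fun \<theta> (\<lambda>x. f x + f' x) = (\<lambda>g. unit_fun \<theta> f g + unit_fun \<theta> f' g)"
  by (rule ext) (simp add: unit_fun_def)

lemma unit_fun_scale: "unit_fun \<theta> (\<lambda>x. c * f x) = (\<lambda>g. c * unit_fun \<theta> f g)"
  by (rule ext) (simp add: unit_fun_def)

lemma unit_fun_zero: "unit_fun \<theta> (\<lambda>_. 0) = (\<lambda>_. 0)"
  by (rule ext) (simp add: unit_fun_def)

text \<open>The product \<open>e * e'\<close> is a common lower bound, and it is defined at
  \<open>x\<close> because idempotents act as identities. Hence each point of \<open>X\<close> gives
  a single unit.\<close>

lemma germ_idem_eq:
  assumes "e \<in> idems" "e' \<in> idems" "x \<in> dom (\<theta> e)" "x \<in> dom (\<theta> e')"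
  shows "germ \<theta> e x = germ \<theta> e' x"
proof -
  have "e * e' \<preceq> e" "e * e' \<preceq> e'"
    using assms(1,2) nat_le_iff_right nat_le_def by blast+
  moreover have "x \<in> dom (\<theta> (e * e'))"
    using assms action_idem[OF act assms(2)] by (auto simp: dom_mult)
  ultimately show ?thesis
    using germ_eq by metis
qed

lemma unit_fun_idem:
  assumes "e \<in> idems" "\<And>x. f x \<noteq> 0 \<Longrightarrow> x \<in> dom (\<theta> e)"
  shows "unit_fun \<theta> f = germ_fun \<theta> e f"
proof
  fix g
  show "unit_fun \<theta> f g = germ_fun \<theta> e f g"
  proof (cases "\<exists>e'\<in>idems. g \<in> germ \<theta> e' ` dom (\<theta> e')")
    case True
    then obtain e' x where e': "e' \<in> idems" "x \<in> dom (\<theta> e')" "g = germ \<theta> e' x" by blast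
    then have "unit_fun \<theta> f g = f x"
      using True germ_d_germ[OF act e'(2)] by (simp add: unit_fun_def)
    moreover have "germ_fun \<theta> e f g = f x"
      using assms(2)[of x] germ_idem_eq[OF assms(1) e'(1) _ e'(2)] e'(3)
      by (auto simp: germ_fun_germ[OF e'(2)])
    ultimately show ?thesis by simp
  next
    case False
    then show ?thesis
      using assms(1) by (auto simp: unit_fun_def germ_fun_def)
  qed
qed

lemma unit_fun_cc:
  assumes "f \<in> cc_functions X"
  shows "unit_fun \<theta> f \<in> cc_functions \<G>"
  using assms
proof (induction rule: cc_X_induct)
  case (idem e f)
  then have "unit_fun \<theta> f = germ_fun \<theta> e f"
    by (intro unit_fun_idem) (auto simp: cc_dom_iff)
  then show ?case
    using germ_fun_cc idem by simp
qed (simp_all add: unit_fun_zero unit_fun_add cc_functions_zero cc_functions_add)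

lemma translate_idem:
  assumes "e \<in> idems"
  shows "translate \<theta> (e\<^sup>\<star>) f x = (if x \<in> dom (\<theta> e) then f x else 0)"
  using action_idem[OF act assms] by (auto simp: translate_star_apply split: option.splits)

text \<open>By biadditivity both factors may be taken supported on domains of idempotents, where
  \<open>unit_fun\<close> is a \<open>germ_fun\<close> and \<open>convolution_germ_fun\<close>
  applies.\<close>

lemma unit_fun_mult:
  assumes "f \<in> cc_functions X" "f' \<in> cc_functions X"
  shows "unit_fun \<theta> (pointwise_mult f f') = convolution \<theta> (unit_fun \<theta> f) (unit_fun \<theta> f')"
  using assms(1)
proof (induction rule: cc_X_induct)
  case zero
  show ?case
    by (simp add: pointwise_mult_def unit_fun_zero convolution_zero_left)
next
  case (add f1 f2)
  then show ?case
    using convolution_add_left[OF unit_fun_cc[OF assms(2)], of "unit_fun \<theta> f1" "unit_fun \<theta> f2"]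
    by (simp add: pointwise_mult_def distrib_right unit_fun_add)
next
  case (idem e f)
  then have f: "f \<in> cc_functions X" "\<And>x. f x \<noteq> 0 \<Longrightarrow> x \<in> dom (\<theta> e)"
    by (auto simp: cc_dom_iff)
  from assms(2) show ?case
  proof (induction rule: cc_X_induct)
    case zero
    show ?case
      by (simp add: pointwise_mult_def unit_fun_zero convolution_zero_right)
  next
    case (add f1 f2)
    then show ?case
      using convolution_add_right[OF unit_fun_cc[OF add.hyps(1)] unit_fun_cc[OF add.hyps(2)]]
      by (simp add: pointwise_mult_def distrib_left unit_fun_add)
  next
    case e': (idem e' f')
    then have f': "\<And>x. f' x \<noteq> 0 \<Longrightarrow> x \<in> dom (\<theta> e')"
      by (auto simp: cc_dom_iff)
    \<comment> \<open>Translation by an idempotent only restricts to its domain, which contains the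
      support of \<open>f'\<close>.\<close>
    have "pointwise_mult (translate \<theta> (e'\<^sup>\<star>) f) f' = pointwise_mult f f'"
    proof
      fix x
      show "pointwise_mult (translate \<theta> (e'\<^sup>\<star>) f) f' x = pointwise_mult f f' x"
        using f'[of x]
        by (cases "f' x = 0") (simp_all add: pointwise_mult_def translate_idem[OF e'(1)])
    qed
    moreover have "unit_fun \<theta> (pointwise_mult f f') = germ_fun \<theta> (e * e') (pointwise_mult f f')"
    proof (rule unit_fun_idem[OF idem_mult_idem[OF idem(1) e'(1)]])
      fix x assume "pointwise_mult f f' x \<noteq> 0"
      then have "f x \<noteq> 0" "f' x \<noteq> 0"
        by (auto simp: pointwise_mult_def)
      then have "x \<in> dom (\<theta> e)" "x \<in> dom (\<theta> e')"
        using f(2) f' by blast+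
      then show "x \<in> dom (\<theta> (e * e'))"
        using action_idem[OF act e'(1)] by (auto simp: dom_mult)
    qed
    ultimately show ?case
      using unit_fun_idem[of e f, OF idem(1) f(2)] unit_fun_idem[of e' f', OF e'(1) f']
        convolution_germ_fun[of f e f' e'] f(2) f' by simp
  qed
qed

abbreviation germ_char :: "'s \<Rightarrow> ('s \<times> 'x) set \<Rightarrow> 'k::{comm_ring, comm_monoid_mult}"
  where "germ_char s \<equiv> germ_fun \<theta> s (char_fun (dom (\<theta> s)))"

lemma char_fun_support: "char_fun U x \<noteq> (0 :: 'k::{comm_ring, comm_monoid_mult}) \<Longrightarrow> x \<in> U"
  by (simp add: char_fun_def split: if_splits)

lemma char_fun_dom_cc: "char_fun (dom (\<theta> s)) \<in> cc_dom s"
  unfolding cc_dom_iff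
  by (intro conjI allI impI char_fun_cc_functions[OF dom_clopen]) (rule char_fun_support)

lemma germ_char_mult:
  "convolution \<theta> (germ_char s) (germ_char t) =
    (germ_char (s * t) :: _ \<Rightarrow> 'k::{comm_ring, comm_monoid_mult})"
proof -
  have "pointwise_mult (translate \<theta> (t\<^sup>\<star>) (char_fun (dom (\<theta> s)))) (char_fun (dom (\<theta> t))) =
      (char_fun (dom (\<theta> (s * t))) :: _ \<Rightarrow> 'k)"
    by (rule ext)
      (auto simp: pointwise_mult_def translate_star_apply char_fun_def dom_mult split: option.splits)
  then show ?thesis
    using convolution_germ_fun[of "char_fun (dom (\<theta> s))" s "char_fun (dom (\<theta> t))" t]
      char_fun_support by metis
qed

text \<open>On the unit space \<open>f\<close> lives over \<open>s\<^sup>\<star> * s\<close>, and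
  \<open>s * (s\<^sup>\<star> * s) = s\<close>. Applying a homomorphism to this factorisation yields
  the formula that recovers it from its representation.\<close>

lemma germ_char_unit_fun:
  assumes "f \<in> cc_dom s"
  shows "convolution \<theta> (germ_char s) (unit_fun \<theta> f) = germ_fun \<theta> s f"
proof -
  have f: "x \<in> dom (\<theta> (s\<^sup>\<star> * s))" if "f x \<noteq> 0" for x
    using that assms by (simp add: cc_dom_iff dom_star_mult[OF act])
  have "pointwise_mult (translate \<theta> ((s\<^sup>\<star> * s)\<^sup>\<star>) (char_fun (dom (\<theta> s)))) f = f"
  proof
    fix x
    show "pointwise_mult (translate \<theta> ((s\<^sup>\<star> * s)\<^sup>\<star>) (char_fun (dom (\<theta> s)))) f x = f x"
      using f[of x] by (cases "f x = 0")
        (simp_all add: pointwise_mult_def translate_idem[OF star_mult_idem(1)] char_fun_def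
          dom_star_mult[OF act])
  qed
  then show ?thesis
    using unit_fun_idem[of "s\<^sup>\<star> * s" f, OF star_mult_idem(1) f]
      convolution_germ_fun[of "char_fun (dom (\<theta> s))" s f "s\<^sup>\<star> * s", OF char_fun_support f]
    by (simp add: star_inverse flip: mult.assoc)
qed

text \<open>The product lives over the idempotent \<open>s * s\<^sup>\<star>\<close>, hence on the
  unit space. Together with \<open>germ_char_unit_fun\<close> it gives covariance condition
  (1).\<close>

lemma germ_fun_germ_char_star:
  assumes "f \<in> cc_dom s"
  shows "convolution \<theta> (germ_fun \<theta> s f) (germ_char (s\<^sup>\<star>)) = unit_fun \<theta> (translate \<theta> s f)"
proof -
  have f: "x \<in> dom (\<theta> s)" if "f x \<noteq> 0" for x
    using that assms by (simp add: cc_dom_iff)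
  have dom: "dom (\<theta> (s * s\<^sup>\<star>)) = dom (\<theta> (s\<^sup>\<star>))"
    using dom_star_mult[OF act, of "s\<^sup>\<star>"] by (simp add: star_star)
  have tr: "x \<in> dom (\<theta> (s * s\<^sup>\<star>))" if "translate \<theta> s f x \<noteq> 0" for x
    using that by (simp add: translate_def split: if_splits)
  have "pointwise_mult (translate \<theta> s f) (char_fun (dom (\<theta> (s\<^sup>\<star>)))) = translate \<theta> s f"
  proof
    fix x
    show "pointwise_mult (translate \<theta> s f) (char_fun (dom (\<theta> (s\<^sup>\<star>)))) x = translate \<theta> s f x"
      using tr[of x] by (cases "translate \<theta> s f x = 0")
        (simp_all add: pointwise_mult_def char_fun_def dom)
  qed
  then show ?thesis
    using unit_fun_idem[of "s * s\<^sup>\<star>" "translate \<theta> s f", OF star_mult_idem(2) tr]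
      convolution_germ_fun[of f s "char_fun (dom (\<theta> (s\<^sup>\<star>)))" "s\<^sup>\<star>", OF f char_fun_support]
    by (simp add: star_star)
qed

end


section \<open>From homomorphisms to covariant representations\<close>

text \<open>The restriction makes the first component \<open>undefined\<close> off
  \<open>cc_functions X\<close>, as membership in \<open>algebra_homs\<close> demands.\<close>

definition induced_rep ::
    "'x topology \<Rightarrow> ('s::inverse_semigroup \<Rightarrow> 'x \<rightharpoonup> 'x) \<Rightarrow>
     ((('s \<times> 'x) set \<Rightarrow> 'k::{comm_ring, comm_monoid_mult}) \<Rightarrow> 'a) \<Rightarrow>
     (('x \<Rightarrow> 'k) \<Rightarrow> 'a) \<times> ('s \<Rightarrow> 'a)"
  where "induced_rep X \<theta> \<phi> =
    (restrict (\<lambda>f. \<phi> (unit_fun \<theta> f)) (cc_functions X),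
     \<lambda>s. \<phi> (germ_fun \<theta> s (char_fun (dom (\<theta> s)))))"

lemma algebra_homsD:
  assumes "\<phi> \<in> algebra_homs smul C mul"
  shows "\<phi> \<in> C \<rightarrow>\<^sub>E UNIV"
    and "f \<in> C \<Longrightarrow> g \<in> C \<Longrightarrow> \<phi> (\<lambda>y. f y + g y) = \<phi> f + \<phi> g"
    and "f \<in> C \<Longrightarrow> \<phi> (\<lambda>y. c * f y) = smul c (\<phi> f)"
    and "f \<in> C \<Longrightarrow> g \<in> C \<Longrightarrow> \<phi> (mul f g) = \<phi> f * \<phi> g"
  using assms unfolding algebra_homs_def by blast+

lemma algebra_homs_zero:
  assumes "\<phi> \<in> algebra_homs smul C mul" "(\<lambda>_. 0) \<in> C"
  shows "\<phi> (\<lambda>_. 0) = 0"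
  using algebra_homsD(2)[OF assms(1) assms(2) assms(2)] by simp

context ample_germs
begin

lemma germ_char_cc: "germ_char s \<in> cc_functions \<G>"
  by (rule germ_fun_cc[OF char_fun_dom_cc])

lemma cc_dom_subset: "f \<in> cc_dom s \<Longrightarrow> f \<in> cc_functions X"
  by (simp add: cc_dom_iff)

text \<open>Every condition is the image under \<phi> of an identity between functions on the
  groupoid.\<close>

lemma induced_rep_covariant:
  fixes smul :: "'k::{comm_ring, comm_monoid_mult} \<Rightarrow> 'a::ring \<Rightarrow> 'a"
  assumes \<phi>: "\<phi> \<in> algebra_homs smul (cc_functions \<G>) (convolution \<theta>)"
  shows "induced_rep X \<theta> \<phi> \<in> covariant_reps smul X \<theta>"
  unfolding induced_rep_def covariant_reps_def mem_Collect_eq prod.case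
proof (intro conjI allI ballI)
  let ?\<pi> = "restrict (\<lambda>f. \<phi> (unit_fun \<theta> f)) (cc_functions X)"
  note hom = algebra_homsD[OF \<phi>]
  show "?\<pi> \<in> algebra_homs smul (cc_functions X) pointwise_mult"
    unfolding algebra_homs_def mem_Collect_eq
  proof (intro conjI ballI allI)
    fix f g :: "'x \<Rightarrow> 'k" and c :: 'k
    assume f: "f \<in> cc_functions X"
    show "?\<pi> (\<lambda>x. c * f x) = smul c (?\<pi> f)"
      using f hom(3)[OF unit_fun_cc[OF f]] by (simp add: cc_functions_scale unit_fun_scale)
    assume g: "g \<in> cc_functions X"
    show "?\<pi> (\<lambda>x. f x + g x) = ?\<pi> f + ?\<pi> g"
      using f g hom(2)[OF unit_fun_cc[OF f] unit_fun_cc[OF g]]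
      by (simp add: cc_functions_add unit_fun_add)
    show "?\<pi> (pointwise_mult f g) = ?\<pi> f * ?\<pi> g"
      using f g hom(4)[OF unit_fun_cc[OF f] unit_fun_cc[OF g]]
      by (simp add: cc_functions_mult unit_fun_mult)
  qed simp
  show "\<phi> (germ_char (s * t)) = \<phi> (germ_char s) * \<phi> (germ_char t)" for s t
    using hom(4)[OF germ_char_cc germ_char_cc] by (simp add: germ_char_mult)
  show "?\<pi> (translate \<theta> s f) = \<phi> (germ_char s) * ?\<pi> f * \<phi> (germ_char (s\<^sup>\<star>))"
    if "f \<in> cc_functions (subtopology X (dom (\<theta> (s\<^sup>\<star> * s))))" for s f
  proof -
    have f: "f \<in> cc_dom s"
      using that unfolding dom_star_mult[OF act] .
    have "\<phi> (germ_char s) * \<phi> (unit_fun \<theta> f) = \<phi> (germ_fun \<theta> s f)"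
      using hom(4)[OF germ_char_cc[of s] unit_fun_cc[OF cc_dom_subset[OF f]]]
      by (simp add: germ_char_unit_fun[OF f])
    moreover have "\<phi> (germ_fun \<theta> s f) * \<phi> (germ_char (s\<^sup>\<star>)) = \<phi> (unit_fun \<theta> (translate \<theta> s f))"
      using hom(4)[OF germ_fun_cc[OF f] germ_char_cc[of "s\<^sup>\<star>"]]
      by (simp add: germ_fun_germ_char_star[OF f])
    ultimately show ?thesis
      using cc_dom_subset[OF f] cc_dom_subset[OF translate_cc[OF cc_dom_subset[OF f]]] by simp
  qed
  show "?\<pi> (char_fun (dom (\<theta> e))) = \<phi> (germ_char e)" if "e \<in> idems" for e
  proof -
    have "unit_fun \<theta> (char_fun (dom (\<theta> e))) = (germ_char e :: _ \<Rightarrow> 'k)"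
      by (rule unit_fun_idem[OF that]) (rule char_fun_support)
    moreover have "(char_fun (dom (\<theta> e)) :: _ \<Rightarrow> 'k) \<in> cc_functions X"
      by (rule cc_dom_subset[OF char_fun_dom_cc])
    ultimately show ?thesis by simp
  qed
qed

text \<open>The functions \<open>germ_fun \<theta> s f\<close> span, and each is a convolution of
  two functions on which the induced pair fixes the homomorphism.\<close>

lemma inj_on_induced_rep:
  "inj_on (induced_rep X \<theta>) (algebra_homs smul (cc_functions \<G>) (convolution \<theta>))"
proof (rule inj_onI)
  fix \<phi> \<psi>
  assume \<phi>: "\<phi> \<in> algebra_homs smul (cc_functions \<G>) (convolution \<theta>)"
    and \<psi>: "\<psi> \<in> algebra_homs smul (cc_functions \<G>) (convolution \<theta>)"
    and eq: "induced_rep X \<theta> \<phi> = induced_rep X \<theta> \<psi>"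
  have unit: "\<phi> (unit_fun \<theta> f) = \<psi> (unit_fun \<theta> f)" if "f \<in> cc_functions X" for f
  proof -
    have "restrict (\<lambda>f. \<phi> (unit_fun \<theta> f)) (cc_functions X) f =
        restrict (\<lambda>f. \<psi> (unit_fun \<theta> f)) (cc_functions X) f"
      using eq unfolding induced_rep_def prod.inject by metis
    with that show ?thesis by simp
  qed
  have char: "\<phi> (germ_char s) = \<psi> (germ_char s)" for s
    using eq unfolding induced_rep_def prod.inject by metis
  have "\<phi> a = \<psi> a" if "a \<in> cc_functions \<G>" for a
    using that
  proof (induction rule: cc_germ_induct)
    case zero
    show ?case
      using algebra_homs_zero \<phi> \<psi> cc_functions_zero by metis
  next
    case (add a b)
    then show ?case
      using algebra_homsD(2)[OF \<phi>] algebra_homsD(2)[OF \<psi>] by simp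
  next
    case (germ_fun s f)
    have "\<rho> (germ_fun \<theta> s f) = \<rho> (germ_char s) * \<rho> (unit_fun \<theta> f)"
      if "\<rho> \<in> algebra_homs smul (cc_functions \<G>) (convolution \<theta>)" for \<rho>
      using algebra_homsD(4)[OF that germ_char_cc[of s] unit_fun_cc[OF cc_dom_subset[OF germ_fun]]]
      by (simp add: germ_char_unit_fun[OF germ_fun])
    from this[OF \<phi>] this[OF \<psi>] show ?case
      using unit[OF cc_dom_subset[OF germ_fun]] char[of s] by simp
  qed
  then show "\<phi> = \<psi>"
    by (rule PiE_ext[OF algebra_homsD(1)[OF \<phi>] algebra_homsD(1)[OF \<psi>]])
qed

end


section \<open>From covariant representations to homomorphisms\<close>

locale covariant_rep = ample_germs X \<theta> + K_algebra smul
  for X :: "'x topology" and \<theta> :: "'s::inverse_semigroup \<Rightarrow> 'x \<rightharpoonup> 'x"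
    and smul :: "'k::{comm_ring, comm_monoid_mult} \<Rightarrow> 'a::ring \<Rightarrow> 'a" +
  fixes \<pi> :: "('x \<Rightarrow> 'k) \<Rightarrow> 'a" and \<sigma> :: "'s \<Rightarrow> 'a"
  assumes covariant: "(\<pi>, \<sigma>) \<in> covariant_reps smul X \<theta>"
begin

section \<open>Relations in a covariant representation\<close>

lemma pi_hom: "\<pi> \<in> algebra_homs smul (cc_functions X) pointwise_mult"
  using covariant by (simp add: covariant_reps_def)

lemmas pi_add = algebra_homsD(2)[OF pi_hom]
  and pi_scale = algebra_homsD(3)[OF pi_hom]
  and pi_mult = algebra_homsD(4)[OF pi_hom]
  and pi_zero = algebra_homs_zero[OF pi_hom cc_functions_zero]

lemma sigma_mult: "\<sigma> (s * t) = \<sigma> s * \<sigma> t"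
  using covariant by (simp add: covariant_reps_def)

lemma sigma_conj: "f \<in> cc_dom s \<Longrightarrow> \<pi> (translate \<theta> s f) = \<sigma> s * \<pi> f * \<sigma> (s\<^sup>\<star>)"
  using covariant by (simp add: covariant_reps_def dom_star_mult[OF act])

lemma pi_char: "e \<in> idems \<Longrightarrow> \<pi> (char_fun (dom (\<theta> e))) = \<sigma> e"
  using covariant by (simp add: covariant_reps_def)

text \<open>By condition (2), \<open>\<sigma> e\<close> is \<pi> of the characteristic function of
  \<open>dom (\<theta> e)\<close>, a unit for functions supported there.\<close>

lemma pi_idem:
  assumes "e \<in> idems" "f \<in> cc_dom e"
  shows "\<sigma> e * \<pi> f = \<pi> f" "\<pi> f * \<sigma> e = \<pi> f"
proof -
  have "pointwise_mult (char_fun (dom (\<theta> e))) f x = f x"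
    "pointwise_mult f (char_fun (dom (\<theta> e))) x = f x" for x
    using assms(2) by (cases "f x = 0"; simp add: pointwise_mult_def char_fun_def cc_dom_iff)+
  then have "pointwise_mult (char_fun (dom (\<theta> e))) f = f"
    "pointwise_mult f (char_fun (dom (\<theta> e))) = f"
    by blast+
  then show "\<sigma> e * \<pi> f = \<pi> f" "\<pi> f * \<sigma> e = \<pi> f"
    using pi_mult[OF cc_dom_subset[OF char_fun_dom_cc] cc_dom_subset[OF assms(2)]]
      pi_mult[OF cc_dom_subset[OF assms(2)] cc_dom_subset[OF char_fun_dom_cc]]
      pi_char[OF assms(1)] by metis+
qed

lemma cc_dom_star_mult: "cc_dom (s\<^sup>\<star> * s) = cc_dom s"
  by (simp add: dom_star_mult[OF act])

text \<open>Condition (1) applied to the translate \<open>h\<close> gives \<open>\<sigma> t * \<pi>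
  h * \<sigma> (t\<^sup>\<star>) = \<pi> f * \<sigma> (t * t\<^sup>\<star>)\<close>. Multiplying by
  \<open>\<sigma> t\<close> on the right removes the idempotents. This rule brings products into the
  form \<open>\<sigma> s * \<pi> f\<close>.\<close>

lemma pi_sigma:
  assumes f: "f \<in> cc_functions X"
  shows "\<pi> f * \<sigma> t = \<sigma> t * \<pi> (translate \<theta> (t\<^sup>\<star>) f)"
proof -
  define h where "h = translate \<theta> (t\<^sup>\<star>) f"
  have h: "h \<in> cc_dom t"
    using translate_cc[OF f, of "t\<^sup>\<star>"] by (simp add: h_def star_star)
  have dom: "dom (\<theta> (t * t\<^sup>\<star>)) = dom (\<theta> (t\<^sup>\<star>))"
    using dom_star_mult[OF act, of "t\<^sup>\<star>"] by (simp add: star_star)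
  \<comment> \<open>Translating forth and back cuts \<open>f\<close> down to the range of
    \<open>\<theta> t\<close>, the domain of \<open>\<theta> (t * t\<^sup>\<star>)\<close>.\<close>
  have "translate \<theta> t h = pointwise_mult f (char_fun (dom (\<theta> (t * t\<^sup>\<star>))))"
  proof
    fix x
    show "translate \<theta> t h x = pointwise_mult f (char_fun (dom (\<theta> (t * t\<^sup>\<star>)))) x"
    proof (cases "\<theta> (t\<^sup>\<star>) x")
      case None
      then have "x \<notin> dom (\<theta> (t * t\<^sup>\<star>))"
        by (simp add: dom domIff)
      then show ?thesis
        by (simp add: translate_def pointwise_mult_def char_fun_def)
    next
      case (Some y)
      then have "x \<in> dom (\<theta> (t * t\<^sup>\<star>))"
        by (simp add: dom domI)
      moreover have "\<theta> t y = Some x"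
        using action_star[OF act Some] by (simp add: star_star)
      ultimately show ?thesis
        using Some
        by (simp add: translate_def[of \<theta> t] pointwise_mult_def char_fun_def h_def translate_star_apply)
    qed
  qed
  then have "\<pi> f * \<sigma> (t * t\<^sup>\<star>) = \<sigma> t * \<pi> h * \<sigma> (t\<^sup>\<star>)"
    using sigma_conj[OF h] pi_mult[OF f cc_dom_subset[OF char_fun_dom_cc]]
      pi_char[OF star_mult_idem(2)] by metis
  then have "\<pi> f * \<sigma> (t * t\<^sup>\<star>) * \<sigma> t = \<sigma> t * (\<pi> h * \<sigma> (t\<^sup>\<star> * t))"
    by (simp add: sigma_mult mult.assoc)
  moreover have "\<pi> f * \<sigma> (t * t\<^sup>\<star>) * \<sigma> t = \<pi> f * \<sigma> t"
    by (simp only: mult.assoc[of "\<pi> f"] sigma_mult[symmetric] star_inverse)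
  moreover have "\<pi> h * \<sigma> (t\<^sup>\<star> * t) = \<pi> h"
    using h by (intro pi_idem(2) star_mult_idem(1)) (simp add: cc_dom_star_mult)
  ultimately show ?thesis
    by (simp add: h_def)
qed

text \<open>The factor \<open>\<pi> f\<close> absorbs \<open>\<sigma> (u\<^sup>\<star> * u)\<close>
  from the left, and \<open>s * (u\<^sup>\<star> * u) = u\<close>.\<close>

lemma sigma_nat_le:
  assumes "u \<preceq> s" "f \<in> cc_dom u"
  shows "\<sigma> s * \<pi> f = \<sigma> u * \<pi> f"
proof -
  have "\<pi> f = \<sigma> (u\<^sup>\<star> * u) * \<pi> f"
    using assms(2) by (intro pi_idem(1)[symmetric] star_mult_idem(1)) (simp add: cc_dom_star_mult)
  then have "\<sigma> s * \<pi> f = \<sigma> (s * (u\<^sup>\<star> * u)) * \<pi> f"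
    by (metis sigma_mult mult.assoc)
  then show ?thesis
    by (simp add: nat_le_mult_star[OF assms(1)])
qed

text \<open>The support of \<open>f\<close> is covered by the sets \<open>dom (\<theta> u)\<close> with \<open>u \<preceq> s\<close> and \<open>u \<preceq> t\<close>, and on each of
  them both sides equal \<open>\<sigma> u * \<pi> f\<close>.\<close>

lemma sigma_germ_eq:
  assumes "f \<in> cc_functions X"
    and "\<And>x. f x \<noteq> 0 \<Longrightarrow> x \<in> dom (\<theta> s) \<inter> dom (\<theta> t) \<and> germ \<theta> s x = germ \<theta> t x"
  shows "\<sigma> s * \<pi> f = \<sigma> t * \<pi> f"
proof -
  have "{x. f x \<noteq> 0} \<subseteq> \<Union> ((\<lambda>u. dom (\<theta> u)) ` {u. u \<preceq> s \<and> u \<preceq> t})"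
  proof clarify
    fix x assume "f x \<noteq> 0"
    then have "x \<in> dom (\<theta> s)" "x \<in> dom (\<theta> t)" "germ \<theta> s x = germ \<theta> t x"
      using assms(2) by blast+
    then show "x \<in> \<Union> ((\<lambda>u. dom (\<theta> u)) ` {u. u \<preceq> s \<and> u \<preceq> t})"
      using germ_eq_iff[OF act, of x s x t] by blast
  qed
  with assms(1) show ?thesis
  proof (induction rule: cc_functions_cover_induct)
    case (clopen U)
    then show ?case using dom_clopen by blast
  next
    case (add f g)
    then show ?case by (simp add: pi_add distrib_left)
  next
    case (piece f U)
    then obtain u where u: "u \<preceq> s" "u \<preceq> t" "U = dom (\<theta> u)" by blast
    then have "f \<in> cc_dom u"
      unfolding cc_dom_iff using piece by blast
    then show ?case
      using sigma_nat_le u by metis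
  qed (simp add: pi_zero)
qed

section \<open>Vanishing sums of functions on bisections\<close>

lemma sigma_pi_add:
  assumes "f \<in> cc_dom s" "f' \<in> cc_dom s"
  shows "\<sigma> s * \<pi> (\<lambda>x. f x + f' x) = \<sigma> s * \<pi> f + \<sigma> s * \<pi> f'"
  using pi_add[OF cc_dom_subset[OF assms(1)] cc_dom_subset[OF assms(2)]]
  by (simp add: distrib_left)

text \<open>The sets where \<open>t\<close> has the same germ as some \<open>s\<close> in
  \<open>T\<close> are clopen and cover the support of \<open>f\<close>. A piece inside one of them
  moves to that index, by \<open>sigma_germ_eq\<close> on the algebra side; \<open>h s\<close>
  collects what arrives at \<open>s\<close>.\<close>

lemma germ_fun_redistribute:
  assumes "finite T" "f \<in> cc_functions X"
    and supp: "\<And>x. f x \<noteq> 0 \<Longrightarrow> \<exists>s\<in>T. x \<in> dom (\<theta> t) \<inter> dom (\<theta> s) \<and> germ \<theta> t x = germ \<theta> s x"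
  shows "\<exists>h. (\<forall>s\<in>T. h s \<in> cc_dom s) \<and>
    (\<forall>g. germ_fun \<theta> t f g = (\<Sum>s\<in>T. germ_fun \<theta> s (h s) g)) \<and>
    \<sigma> t * \<pi> f = (\<Sum>s\<in>T. \<sigma> s * \<pi> (h s))"
proof -
  let ?V = "\<lambda>s. {x \<in> dom (\<theta> t) \<inter> dom (\<theta> s). germ \<theta> t x = germ \<theta> s x}"
  have "{x. f x \<noteq> 0} \<subseteq> \<Union> (?V ` T)"
  proof
    fix x assume "x \<in> {x. f x \<noteq> 0}"
    then have "\<exists>s\<in>T. x \<in> dom (\<theta> t) \<inter> dom (\<theta> s) \<and> germ \<theta> t x = germ \<theta> s x"
      using supp by simp
    then show "x \<in> \<Union> (?V ` T)" by blast
  qed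
  with assms(2) show ?thesis
  proof (induction rule: cc_functions_cover_induct)
    case (clopen U)
    then show ?case
      using openin_germ_eq closedin_germ_eq by blast
  next
    case zero
    show ?case
      by (intro exI[of _ "\<lambda>_ _. 0"]) (simp add: pi_zero germ_fun_def cc_functions_zero)
  next
    case (add a b)
    then obtain h k where
      h: "\<forall>s\<in>T. h s \<in> cc_dom s" "\<forall>g. germ_fun \<theta> t a g = (\<Sum>s\<in>T. germ_fun \<theta> s (h s) g)"
        "\<sigma> t * \<pi> a = (\<Sum>s\<in>T. \<sigma> s * \<pi> (h s))" and
      k: "\<forall>s\<in>T. k s \<in> cc_dom s" "\<forall>g. germ_fun \<theta> t b g = (\<Sum>s\<in>T. germ_fun \<theta> s (k s) g)"
        "\<sigma> t * \<pi> b = (\<Sum>s\<in>T. \<sigma> s * \<pi> (k s))"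
      by blast
    let ?h = "\<lambda>s x. h s x + k s x"
    have "\<forall>s\<in>T. ?h s \<in> cc_dom s"
      using h(1) k(1) cc_functions_add by blast
    moreover have "\<forall>g. germ_fun \<theta> t (\<lambda>x. a x + b x) g = (\<Sum>s\<in>T. germ_fun \<theta> s (?h s) g)"
      using h(2) k(2) by (simp add: germ_fun_add sum.distrib)
    moreover have "\<sigma> t * \<pi> (\<lambda>x. a x + b x) = (\<Sum>s\<in>T. \<sigma> s * \<pi> (?h s))"
    proof -
      have "\<sigma> s * \<pi> (?h s) = \<sigma> s * \<pi> (h s) + \<sigma> s * \<pi> (k s)" if "s \<in> T" for s
        using that h(1) k(1) by (intro sigma_pi_add) blast+
      then show ?thesis
        using h(3) k(3) add.hyps by (simp add: pi_add distrib_left sum.distrib)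
    qed
    ultimately show ?case by (intro exI[of _ ?h] conjI)
  next
    case (piece b U)
    then obtain j where j: "j \<in> T" "U = ?V j" by blast
    then have supp_b: "x \<in> dom (\<theta> t) \<inter> dom (\<theta> j) \<and> germ \<theta> t x = germ \<theta> j x" if "b x \<noteq> 0" for x
      using piece(3)[OF that] by blast
    let ?h = "\<lambda>s. if s = j then b else (\<lambda>_. 0)"
    have "b \<in> cc_dom j"
      unfolding cc_dom_iff using piece(1) supp_b by blast
    then have 1: "\<forall>s\<in>T. ?h s \<in> cc_dom s"
      using cc_functions_zero by auto
    have "germ_fun \<theta> t b = germ_fun \<theta> j b"
    proof (rule germ_function_eqI)
      fix r y assume "y \<in> dom (\<theta> r)"
      then show "germ_fun \<theta> t b (germ \<theta> r y) = germ_fun \<theta> j b (germ \<theta> r y)"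
        using supp_b[of y] by (cases "b y = 0") (simp_all add: germ_fun_germ)
    qed (simp add: germ_fun_outside)
    moreover have "germ_fun \<theta> s (?h s) g = (if s = j then germ_fun \<theta> j b g else 0)" for s g
      by (simp add: germ_fun_def)
    ultimately have 2: "\<forall>g. germ_fun \<theta> t b g = (\<Sum>s\<in>T. germ_fun \<theta> s (?h s) g)"
      using j(1) assms(1) by (simp add: sum.delta')
    have "\<sigma> s * \<pi> (?h s) = (if s = j then \<sigma> j * \<pi> b else 0)" for s
      by (simp add: pi_zero)
    then have "\<sigma> t * \<pi> b = (\<Sum>s\<in>T. \<sigma> s * \<pi> (?h s))"
      using j(1) assms(1) sigma_germ_eq[OF piece(1) supp_b] by (simp add: sum.delta')
    with 1 2 show ?case by (intro exI[of _ ?h] conjI)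
  qed
qed

text \<open>Induction on \<open>T\<close>: the summand of one index \<open>t\<close> is
  redistributed over the others, where it is added to their functions.\<close>

lemma sigma_pi_sum_eq_0:
  assumes "finite T" "\<And>s. s \<in> T \<Longrightarrow> F s \<in> cc_dom s"
    and "\<And>g. (\<Sum>s\<in>T. germ_fun \<theta> s (F s) g) = 0"
  shows "(\<Sum>s\<in>T. \<sigma> s * \<pi> (F s)) = 0"
  using assms
proof (induction arbitrary: F)
  case (insert t T)
  have Ft: "F t \<in> cc_functions X"
    using insert.prems(1) cc_dom_subset by blast
  \<comment> \<open>Otherwise no other summand reaches \<open>[t, x]\<close>, and the vanishing sum
    would take the nonzero value \<open>F t x\<close> there.\<close>
  have "\<exists>s\<in>T. x \<in> dom (\<theta> t) \<inter> dom (\<theta> s) \<and> germ \<theta> t x = germ \<theta> s x" if x: "F t x \<noteq> 0" for x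
  proof (rule ccontr)
    assume none: "\<not> ?thesis"
    have t: "x \<in> dom (\<theta> t)"
      using x insert.prems(1) cc_dom_iff by blast
    have "germ_fun \<theta> s (F s) (germ \<theta> t x) = 0" if "s \<in> T" for s
      using none that t by (auto simp: germ_fun_germ[OF t])
    then have "(\<Sum>s\<in>T. germ_fun \<theta> s (F s) (germ \<theta> t x)) = 0"
      by simp
    then show False
      using insert.prems(2)[of "germ \<theta> t x"] insert.hyps t x by (simp add: germ_fun_germ[OF t])
  qed
  from germ_fun_redistribute[OF insert.hyps(1) Ft this]
  obtain h where h: "\<forall>s\<in>T. h s \<in> cc_dom s"
      "\<forall>g. germ_fun \<theta> t (F t) g = (\<Sum>s\<in>T. germ_fun \<theta> s (h s) g)"
      "\<sigma> t * \<pi> (F t) = (\<Sum>s\<in>T. \<sigma> s * \<pi> (h s))"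
    by blast
  let ?F = "\<lambda>s x. F s x + h s x"
  have "(\<Sum>s\<in>T. \<sigma> s * \<pi> (?F s)) = 0"
  proof (rule insert.IH)
    show "?F s \<in> cc_dom s" if "s \<in> T" for s
      using that h(1) insert.prems(1) by (intro cc_functions_add) blast+
    show "(\<Sum>s\<in>T. germ_fun \<theta> s (?F s) g) = 0" for g
      using insert.prems(2)[of g] insert.hyps h(2)[rule_format, of g]
      by (simp add: germ_fun_add sum.distrib add.commute)
  qed
  moreover have "\<sigma> s * \<pi> (?F s) = \<sigma> s * \<pi> (F s) + \<sigma> s * \<pi> (h s)" if "s \<in> T" for s
    using that h(1) insert.prems(1) by (intro sigma_pi_add) blast+
  ultimately show ?case
    using insert.hyps h(3) by (simp add: sum.distrib add.commute)
qed simp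

section \<open>Construction of the homomorphism as a graph\<close>

lemma smul_zero: "smul c 0 = 0"
  using smul_add_right[of c 0 0] by simp

lemma smul_uminus_one: "smul (- 1) v = - v"
proof -
  have "smul 0 v = 0"
    using smul_add_left[of 0 0 v] by simp
  then have "smul (- 1) v + v = 0"
    using smul_add_left[of "- 1" 1 v] by (simp add: smul_one)
  then show ?thesis
    by (simp add: eq_neg_iff_add_eq_0)
qed

text \<open>The graph of the homomorphism to be constructed. It is additive, homogeneous and multiplicative
  by induction, so only its single-valuedness needs the argument with finite families above.\<close>

inductive hom_graph :: "(('s \<times> 'x) set \<Rightarrow> 'k) \<Rightarrow> 'a \<Rightarrow> bool"
  where
    zero: "hom_graph (\<lambda>_. 0) 0"
  | step: "hom_graph a v \<Longrightarrow> f \<in> cc_dom s \<Longrightarrow>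
      hom_graph (\<lambda>g. a g + germ_fun \<theta> s f g) (v + \<sigma> s * \<pi> f)"

lemma hom_graph_germ_fun: "f \<in> cc_dom s \<Longrightarrow> hom_graph (germ_fun \<theta> s f) (\<sigma> s * \<pi> f)"
  using hom_graph.step[OF hom_graph.zero] by simp

lemma hom_graph_add:
  assumes "hom_graph a v" "hom_graph b w"
  shows "hom_graph (\<lambda>g. a g + b g) (v + w)"
  using assms(2)
proof induction
  case (step b w f s)
  then show ?case
    using hom_graph.step[OF step.IH step.hyps(2)] by (simp only: add.assoc)
qed (simp add: assms(1))

lemma hom_graph_scale:
  assumes "hom_graph a v"
  shows "hom_graph (\<lambda>g. c * a g) (smul c v)"
  using assms
proof induction
  case (step a v f s)
  have "(\<lambda>x. c * f x) \<in> cc_dom s"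
    using step.hyps(2) by (rule cc_functions_scale)
  from hom_graph.step[OF step.IH this] show ?case
    using pi_scale[OF cc_dom_subset[OF step.hyps(2)]]
    by (simp add: germ_fun_scale distrib_left smul_add_right smul_mult_right)
qed (simp add: smul_zero hom_graph.zero)

lemma hom_graph_cc: "hom_graph a v \<Longrightarrow> a \<in> cc_functions \<G>"
  by (induction rule: hom_graph.induct) (auto intro: cc_functions_zero cc_functions_add germ_fun_cc)

text \<open>For \<open>b = germ_fun \<theta> t f'\<close>, \<open>pi_sigma\<close> moves
  \<open>\<pi> f\<close> past \<open>\<sigma> t\<close>, producing the same translate as
  \<open>convolution_germ_fun\<close>. The general case follows by additivity.\<close>

lemma hom_graph_germ_fun_mult:
  assumes "f \<in> cc_dom s" "hom_graph b w"
  shows "hom_graph (convolution \<theta> (germ_fun \<theta> s f) b) (\<sigma> s * \<pi> f * w)"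
  using assms(2)
proof induction
  case zero
  then show ?case
    by (simp add: convolution_zero_right hom_graph.zero)
next
  case (step b w f' t)
  let ?h = "pointwise_mult (translate \<theta> (t\<^sup>\<star>) f) f'"
  note f = cc_dom_subset[OF assms(1)] and f' = cc_dom_subset[OF step.hyps(2)]
  note tr = cc_dom_subset[OF translate_cc[OF f, of "t\<^sup>\<star>"]]
  have supp: "x \<in> dom (\<theta> s)" if "f x \<noteq> 0" for x
    using that assms(1) cc_dom_iff by blast
  have supp': "x \<in> dom (\<theta> t)" if "f' x \<noteq> 0" for x
    using that step.hyps(2) cc_dom_iff by blast
  have "x \<in> dom (\<theta> (s * t))" if "?h x \<noteq> 0" for x
  proof -
    have "translate \<theta> (t\<^sup>\<star>) f x \<noteq> 0"
      using that by (auto simp: pointwise_mult_def)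
    then show ?thesis
      using supp by (auto simp: translate_star_apply dom_mult split: option.splits)
  qed
  then have "?h \<in> cc_dom (s * t)"
    unfolding cc_dom_iff using cc_functions_mult[OF tr f'] by blast
  then have "hom_graph (germ_fun \<theta> (s * t) ?h) (\<sigma> (s * t) * \<pi> ?h)"
    by (rule hom_graph_germ_fun)
  moreover have "\<sigma> (s * t) * \<pi> ?h = \<sigma> s * \<pi> f * (\<sigma> t * \<pi> f')"
  proof -
    have "\<sigma> (s * t) * \<pi> ?h = \<sigma> s * (\<sigma> t * \<pi> (translate \<theta> (t\<^sup>\<star>) f)) * \<pi> f'"
      by (simp add: sigma_mult pi_mult[OF tr f'] mult.assoc)
    then show ?thesis
      by (simp add: pi_sigma[OF f, symmetric] mult.assoc)
  qed
  ultimately have "hom_graph (convolution \<theta> (germ_fun \<theta> s f) (germ_fun \<theta> t f'))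
      (\<sigma> s * \<pi> f * (\<sigma> t * \<pi> f'))"
    using convolution_germ_fun[of f s f' t, OF supp supp'] by simp
  from hom_graph_add[OF step.IH this] show ?case
    by (simp add: convolution_add_right[OF hom_graph_cc[OF step.hyps(1)] germ_fun_cc[OF step.hyps(2)]]
        distrib_left)
qed

lemma hom_graph_mult:
  assumes "hom_graph a v" "hom_graph b w"
  shows "hom_graph (convolution \<theta> a b) (v * w)"
  using assms(1)
proof induction
  case (step a v f s)
  from hom_graph_add[OF step.IH hom_graph_germ_fun_mult[OF step.hyps(2) assms(2)]] show ?case
    by (simp add: convolution_add_left[OF hom_graph_cc[OF assms(2)]] distrib_right)
qed (simp add: convolution_zero_left hom_graph.zero)

lemma hom_graph_exists:
  assumes "a \<in> cc_functions \<G>"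
  shows "\<exists>v. hom_graph a v"
  using assms by (induction rule: cc_germ_induct)
    (blast intro: hom_graph.zero hom_graph_add hom_graph_germ_fun)+

text \<open>A derivation may use the same index several times, whereas
  \<open>sigma_pi_sum_eq_0\<close> needs one function per index. Repeated indices are merged by
  adding their functions.\<close>

lemma hom_graph_family:
  assumes "hom_graph a v"
  shows "\<exists>T F. finite T \<and> (\<forall>s\<in>T. F s \<in> cc_dom s) \<and>
    (\<forall>g. a g = (\<Sum>s\<in>T. germ_fun \<theta> s (F s) g)) \<and> v = (\<Sum>s\<in>T. \<sigma> s * \<pi> (F s))"
  using assms
proof induction
  case zero
  then show ?case
    by (intro exI[of _ "{}"]) simp
next
  case (step a v f t)
  then obtain T F where TF: "finite T" "\<forall>s\<in>T. F s \<in> cc_dom s"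
      "\<forall>g. a g = (\<Sum>s\<in>T. germ_fun \<theta> s (F s) g)" "v = (\<Sum>s\<in>T. \<sigma> s * \<pi> (F s))"
    by blast
  show ?case
  proof (cases "t \<in> T")
    case True
    let ?F = "F(t := (\<lambda>x. F t x + f x))"
    have "\<forall>s\<in>T. ?F s \<in> cc_dom s"
      using TF(2) step.hyps(2) True by (auto intro: cc_functions_add)
    moreover have "a g + germ_fun \<theta> t f g = (\<Sum>s\<in>T. germ_fun \<theta> s (?F s) g)" for g
      using TF(1,3) True by (simp add: sum.remove[OF TF(1) True] germ_fun_add add_ac)
    moreover have "v + \<sigma> t * \<pi> f = (\<Sum>s\<in>T. \<sigma> s * \<pi> (?F s))"
    proof -
      have "\<pi> (\<lambda>x. F t x + f x) = \<pi> (F t) + \<pi> f"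
        using TF(2) True step.hyps(2) by (intro pi_add cc_dom_subset) blast+
      then show ?thesis
        using TF(4) by (simp add: sum.remove[OF TF(1) True] distrib_left add_ac)
    qed
    ultimately show ?thesis
      using TF(1) by (intro exI[of _ T] exI[of _ ?F] conjI allI)
  next
    case False
    let ?F = "F(t := f)"
    have "\<forall>s\<in>insert t T. ?F s \<in> cc_dom s"
      using TF(2) step.hyps(2) by simp
    moreover have "(\<Sum>s\<in>T. germ_fun \<theta> s (?F s) g) = (\<Sum>s\<in>T. germ_fun \<theta> s (F s) g)" for g
      using False by (intro sum.cong) auto
    moreover have "(\<Sum>s\<in>T. \<sigma> s * \<pi> (?F s)) = (\<Sum>s\<in>T. \<sigma> s * \<pi> (F s))"
      using False by (intro sum.cong) auto
    ultimately show ?thesis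
      using TF False by (intro exI[of _ "insert t T"] exI[of _ ?F]) (simp add: add.commute)
  qed
qed

lemma hom_graph_unique:
  assumes "hom_graph a v" "hom_graph a w"
  shows "v = w"
proof -
  \<comment> \<open>Subtracting the two derivations reduces uniqueness to the zero function.\<close>
  have "hom_graph (\<lambda>g. a g + (- 1) * a g) (v + smul (- 1) w)"
    by (intro hom_graph_add hom_graph_scale assms)
  then have "hom_graph (\<lambda>_. 0) (v - w)"
    by (simp add: smul_uminus_one)
  from hom_graph_family[OF this]
  obtain T F where TF: "finite T" "\<forall>s\<in>T. F s \<in> cc_dom s"
      "\<forall>g. 0 = (\<Sum>s\<in>T. germ_fun \<theta> s (F s) g)" "v - w = (\<Sum>s\<in>T. \<sigma> s * \<pi> (F s))"
    by blast
  have "(\<Sum>s\<in>T. \<sigma> s * \<pi> (F s)) = 0"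
  proof (rule sigma_pi_sum_eq_0[OF TF(1)])
    show "F s \<in> cc_dom s" if "s \<in> T" for s
      using TF(2) that by blast
    show "(\<Sum>s\<in>T. germ_fun \<theta> s (F s) g) = 0" for g
      using TF(3) by metis
  qed
  with TF(4) show ?thesis by simp
qed

text \<open>The description is proper on the carrier by \<open>hom_graph_exists\<close> and
  \<open>hom_graph_unique\<close>.\<close>

definition integrated_form :: "(('s \<times> 'x) set \<Rightarrow> 'k) \<Rightarrow> 'a"
  where "integrated_form = restrict (\<lambda>a. THE v. hom_graph a v) (cc_functions \<G>)"

lemma integrated_form_eq: "hom_graph a v \<Longrightarrow> integrated_form a = v"
  using hom_graph_unique hom_graph_cc by (auto simp: integrated_form_def intro: the_equality)

lemma hom_graph_integrated_form: "a \<in> cc_functions \<G> \<Longrightarrow> hom_graph a (integrated_form a)"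
  using hom_graph_exists integrated_form_eq by metis

lemma integrated_form_hom:
  "integrated_form \<in> algebra_homs smul (cc_functions \<G>) (convolution \<theta>)"
  unfolding algebra_homs_def mem_Collect_eq
proof (intro conjI ballI allI)
  show "integrated_form \<in> cc_functions \<G> \<rightarrow>\<^sub>E UNIV"
    by (simp add: integrated_form_def)
  fix a b :: "('s \<times> 'x) set \<Rightarrow> 'k" and c assume a: "a \<in> cc_functions \<G>"
  note a' = hom_graph_integrated_form[OF a]
  show "integrated_form (\<lambda>g. c * a g) = smul c (integrated_form a)"
    by (rule integrated_form_eq[OF hom_graph_scale[OF a']])
  assume "b \<in> cc_functions \<G>"
  note b' = hom_graph_integrated_form[OF this]
  show "integrated_form (\<lambda>g. a g + b g) = integrated_form a + integrated_form b"
    by (rule integrated_form_eq[OF hom_graph_add[OF a' b']])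
  show "integrated_form (convolution \<theta> a b) = integrated_form a * integrated_form b"
    by (rule integrated_form_eq[OF hom_graph_mult[OF a' b']])
qed

text \<open>Over an idempotent \<open>e\<close> the graph gives \<open>\<sigma> e * \<pi> f\<close>,
  which \<open>pi_idem\<close> reduces to \<open>\<pi> f\<close>.\<close>

lemma hom_graph_unit_fun:
  assumes "f \<in> cc_functions X"
  shows "hom_graph (unit_fun \<theta> f) (\<pi> f)"
  using assms
proof (induction rule: cc_X_induct)
  case zero
  show ?case by (simp add: unit_fun_zero pi_zero hom_graph.zero)
next
  case (add f g)
  then show ?case
    using hom_graph_add by (simp add: unit_fun_add pi_add)
next
  case (idem e f)
  then have "unit_fun \<theta> f = germ_fun \<theta> e f"
    by (intro unit_fun_idem) (auto simp: cc_dom_iff)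
  then show ?case
    using hom_graph_germ_fun[OF idem(2)] pi_idem(1)[OF idem] by simp
qed

lemma induced_rep_integrated_form: "induced_rep X \<theta> integrated_form = (\<pi>, \<sigma>)"
proof -
  have "restrict (\<lambda>f. integrated_form (unit_fun \<theta> f)) (cc_functions X) = \<pi>"
    using algebra_homsD(1)[OF pi_hom] integrated_form_eq[OF hom_graph_unit_fun]
    by (intro ext) (auto simp: restrict_def PiE_iff extensional_def)
  moreover have "integrated_form (germ_char s) = \<sigma> s" for s
  proof -
    have "integrated_form (germ_char s) = \<sigma> s * \<pi> (char_fun (dom (\<theta> s)))"
      by (rule integrated_form_eq[OF hom_graph_germ_fun[OF char_fun_dom_cc]])
    \<comment> \<open>The domain of \<open>s\<close> is that of the idempotent
      \<open>s\<^sup>\<star> * s\<close>, so condition (2) evaluates \<pi> here.\<close>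
    also have "\<dots> = \<sigma> (s * (s\<^sup>\<star> * s))"
      using pi_char[OF star_mult_idem(1), of s] by (simp add: dom_star_mult[OF act] sigma_mult)
    finally show ?thesis
      by (simp add: star_inverse flip: mult.assoc)
  qed
  ultimately show ?thesis
    by (simp add: induced_rep_def)
qed

end

theorem theorem4p27:
  fixes X :: "'x topology"
    and \<theta> :: "'s::inverse_semigroup \<Rightarrow> 'x \<rightharpoonup> 'x"
    and smul :: "'k::{comm_ring, comm_monoid_mult} \<Rightarrow> 'a::ring \<Rightarrow> 'a"
  assumes "ample_action X \<theta>"
    and "Hausdorff_space (germ_topology X \<theta>)"
    and "K_algebra smul"
  shows "\<exists>F. bij_betw F
      (algebra_homs smul (cc_functions (germ_topology X \<theta>)) (convolution \<theta>))
      (covariant_reps smul X \<theta>)"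
proof -
  interpret ample_germs X \<theta>
    using assms(1,2) by unfold_locales
  have "covariant_reps smul X \<theta> \<subseteq>
      induced_rep X \<theta> ` algebra_homs smul (cc_functions (germ_topology X \<theta>)) (convolution \<theta>)"
  proof
    fix p assume "p \<in> covariant_reps smul X \<theta>"
    \<comment> \<open>Surjectivity: the integrated form of an arbitrary pair is a preimage of
      it.\<close>
    then interpret covariant_rep X \<theta> smul "fst p" "snd p"
      using assms(3) by (intro covariant_rep.intro covariant_rep_axioms.intro)
        (simp_all add: ample_germs_axioms)
    show "p \<in> induced_rep X \<theta> `
        algebra_homs smul (cc_functions (germ_topology X \<theta>)) (convolution \<theta>)"
      using induced_rep_integrated_form integrated_form_hom by (metis imageI prod.collapse)
  qed
  then have "bij_betw (induced_rep X \<theta>)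
      (algebra_homs smul (cc_functions (germ_topology X \<theta>)) (convolution \<theta>))
      (covariant_reps smul X \<theta>)"
    unfolding bij_betw_def using inj_on_induced_rep induced_rep_covariant by blast
  then show ?thesis by blast
qed

end
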